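(* The D2D outage probability for the adaptive transmission probability (ATP) scheme, $P_{out,d}^{\mathsf{ATP}}(\gamma_d)$, i.e. the probability that the SINR $\Gamma_i$ at a D2D receiver is less than $\gamma_d$, can be expressed as $$P_{out,d}^{\mathsf{ATP}}(\gamma_d)=1-\exp\!\left(-\frac{\gamma_dN_0}{P_d\,r_d^{-\alpha}}\right)\exp\!\left(-\pi\lambda_t^{\mathsf{ATP}}\int_{r_p^2}^{\infty}\frac{dv}{1+\frac{r_d^{-\alpha}v^{\alpha/2}}{\gamma_d}}\right)O_1^{\mathsf{ATP}},\qquad O_1^{\mathsf{ATP}}=\int_0^{2R}\frac{1}{1+\frac{\gamma_dP_c\,r^{-\alpha}}{P_d\,r_d^{-\alpha}}}\,f_{d_{c,i}}(r)\,dr,$$ where $$f_{d_{c,i}}(r)=\frac{2r}{R^2}\left(\frac2\pi\arccos\left(\frac{r}{2R}\right)-\frac{r}{\pi R}\sqrt{1-\frac{r^2}{4R^2}}\right),\qquad 0\le r\le2R,$$ and, by Gaussian–Chebyshev quadrature, $$O_1^{\mathsf{ATP}}\approx\frac{R\pi}{K}\sum_{k=1}^{K}\frac{\sqrt{1-x_k^2}}{1+\frac{\gamma_dP_c\,b_k^{-\alpha}}{P_d\,r_d^{-\alpha}}}\,f_{d_{c,i}}(b_k),$$ with $K$ a parameter that guarantees an accuracy-complexity tradeoff, $x_k=\cos\left(\frac{2k-1}{2K}\pi\right)$ and $b_k=Rx_k+R$.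
   Context: $\Gamma(\cdot)$ with a numerical argument is the Gamma function. A base station (BS) is at the center of a cell of radius $R$; a cellular user is randomly located within the cell and transmits in uplink sub-slots with power $P_c$. D2D transmitters are distributed according to a homogeneous Poisson point process of density $\lambda_d$; each D2D receiver is at distance $r_d$ from its transmitter. Each D2D transmitter harvests energy in downlink sub-slots from the BS (power $P_b$, conversion efficiency $0<\eta\le1$) and is operable if its battery level is at least a threshold $E_{th}$. In the ATP scheme each operable D2D transmitter $i$ senses the channel for a time $t_s^iT_s$, with $t_s^i$ uniform on $[0,1]$ and $T_s$ the sensing duration, consuming power $P_s$ (sub-slots have unit duration); those that detect no nearby transmission transmit with power $P_d$, the others remain idle. With $\beta_{th}$ the protection power threshold, each operable transmitter has a circular protection region around it of average radius $r_p=\left(\frac{P_d}{\beta_{th}}\right)^{1/\alpha}\Gamma\left(1+\frac1\alpha\right)$; by assuming $r_p\gg r_d$, a D2D receiver is also protected by the sensing done by its transmitter. An operable transmitter transmits with probability $p_t^{\mathsf{ATP}}=\frac{1-\exp(-W\pi_o^{\mathsf{ATP}})}{W\pi_o^{\mathsf{ATP}}}$, $W=\frac{2\pi\,\Gamma(2/\alpha)\,\lambda_d}{\alpha(\beta_{th}/P_d)^{2/\alpha}}$, and the probability $\pi_o^{\mathsf{ATP}}$ of being operable satisfies $$\pi_o^{\mathsf{ATP}}=\int_0^R\min\left(1,\frac{\eta P_b\,r^{-\alpha}}{P_s\frac{T_s}{2}+P_d\left(1-\frac{T_s}{2}\right)p_t^{\mathsf{ATP}}}\right)\frac{2r}{R^2}\,dr.$$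 $\phi_t$ denotes the set of D2D transmitters that are operable and transmit, and $\lambda_t^{\mathsf{ATP}}$ its density. The SINR at the $i$-th D2D receiver in uplink sub-slots is $$\Gamma_i=\frac{P_d|h_{i,i}|^2r_d^{-\alpha}}{\sum_{j\in\phi_t,\,j\ne i}P_d|h_{j,i}|^2d_{j,i}^{-\alpha}+P_c|h_{c,i}|^2d_{c,i}^{-\alpha}+N_0},$$ where $\alpha$ is the path loss exponent, $d_{j,i}$ is the distance from D2D transmitter $j$ to receiver $i$, $d_{c,i}$ (with density $f_{d_{c,i}}$, the density of the distance between two randomly distributed nodes in a disk of radius $R$) is the distance from the cellular user to receiver $i$, $N_0$ is the noise power, and the gains $|h_{i,i}|^2,|h_{j,i}|^2,|h_{c,i}|^2$ are exponentially distributed with mean $1$ (Rayleigh fading). The D2D interference factor is evaluated in the paper as $$\mathbb{E}_{\phi_t,h_{j,i}}\left[\prod_{j\in\phi_t}\exp\left(-\frac{\gamma_d|h_{j,i}|^2d_{j,i}^{-\alpha}}{r_d^{-\alpha}}\right)\right]=\exp\left(-2\pi\lambda_t^{\mathsf{ATP}}\int_{r_p}^\infty\left(1-\mathbb{E}_{h_{j,i}}\left[\exp\left(-\frac{\gamma_d|h_{j,i}|^2r^{-\alpha}}{r_d^{-\alpha}}\right)\right]\right)r\,dr\right).$$ *)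

theory Defs
  imports "HOL-Probability.Probability"
begin

type_synonym point = "real \<times> real"

text \<open>Independence of two random variables; \<open>prob_space.indep_var\<close> requires both to have
  values in the same type.\<close>

definition indep_rvs :: "'a measure \<Rightarrow> 'b measure \<Rightarrow> ('a \<Rightarrow> 'b) \<Rightarrow> 'c measure \<Rightarrow> ('a \<Rightarrow> 'c) \<Rightarrow> bool" where
  "indep_rvs M S f T g \<longleftrightarrow> f \<in> measurable M S \<and> g \<in> measurable M T \<and>
     prob_space.indep_set M {f -` A \<inter> space M |A. A \<in> sets S} {g -` B \<inter> space M |B. B \<in> sets T}"

text \<open>A homogeneous Poisson point process in the plane, given by labelled points
  \<open>X j\<close>, \<open>j \<in> J\<close>. The finiteness clause is needed because \<open>card\<close> is 0 on infinite sets.\<close>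

definition point_count :: "(nat \<Rightarrow> 'a \<Rightarrow> point) \<Rightarrow> nat set \<Rightarrow> point set \<Rightarrow> 'a \<Rightarrow> nat" where
  "point_count X J B \<omega> = card {j \<in> J. X j \<omega> \<in> B}"

definition homogeneous_ppp :: "'a measure \<Rightarrow> real \<Rightarrow> (nat \<Rightarrow> 'a \<Rightarrow> point) \<Rightarrow> nat set \<Rightarrow> bool" where
  "homogeneous_ppp M lam X J \<longleftrightarrow>
     (\<forall>j\<in>J. X j \<in> borel_measurable M) \<and>
     (\<forall>B. B \<in> sets borel \<longrightarrow> bounded B \<longrightarrow>
        (AE \<omega> in M. finite {j \<in> J. X j \<omega> \<in> B}) \<and>
        distr M (count_space UNIV) (point_count X J B)
          = measure_pmf (poisson_pmf (lam * measure lborel B))) \<and>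
     (\<forall>\<B>. finite \<B> \<longrightarrow> disjoint \<B> \<longrightarrow> (\<forall>B\<in>\<B>. B \<in> sets borel \<and> bounded B) \<longrightarrow>
        prob_space.indep_vars M (\<lambda>_. count_space UNIV) (point_count X J) \<B>)"

text \<open>Unordered, possibly infinite product; for factors in \<open>[0,1]\<close> the limit always exists
  (it is 0 when the product diverges to 0).\<close>

definition infprod :: "('i \<Rightarrow> real) \<Rightarrow> 'i set \<Rightarrow> real" where
  "infprod f A = Lim (finite_subsets_at_top A) (\<lambda>F. prod f F)"

text \<open>\<open>exp (- x)\<close> for \<open>x \<in> [0,\<infinity>]\<close>. The exponents below are integrals that are infinite
  for path loss exponents at most 2.\<close>

definition exp_neg :: "ennreal \<Rightarrow> real" where
  "exp_neg x = (if x = \<top> then 0 else exp (- enn2real x))"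

definition active_set :: "real \<Rightarrow> (nat \<Rightarrow> 'a \<Rightarrow> real) \<Rightarrow> (nat \<Rightarrow> 'a \<Rightarrow> bool) \<Rightarrow> 'a \<Rightarrow> nat set" where
  "active_set E_th battery channel_clear \<omega> = {j. E_th \<le> battery j \<omega> \<and> channel_clear j \<omega>}"

definition protection_radius :: "real \<Rightarrow> real \<Rightarrow> real \<Rightarrow> real" where
  "protection_radius \<alpha> P_d \<beta>_th = (P_d / \<beta>_th) powr (1 / \<alpha>) * Gamma (1 + 1 / \<alpha>)"

definition W_ATP :: "real \<Rightarrow> real \<Rightarrow> real \<Rightarrow> real \<Rightarrow> real" where
  "W_ATP \<alpha> lam_d P_d \<beta>_th =
     2 * pi * Gamma (2 / \<alpha>) * lam_d / (\<alpha> * (\<beta>_th / P_d) powr (2 / \<alpha>))"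

definition transmit_prob :: "real \<Rightarrow> real \<Rightarrow> real" where
  "transmit_prob W \<pi>_o = (1 - exp (- (W * \<pi>_o))) / (W * \<pi>_o)"

text \<open>SINR at receiver \<open>i\<close>: \<open>h j\<close> and \<open>d j\<close> are the power gain and the distance from
  transmitter \<open>j\<close> to this receiver, \<open>h_c\<close> and \<open>d_c\<close> those from the cellular user.
  It is extended-real valued so that a divergent aggregate interference gives SINR 0
  (\<open>infsum\<close> over the reals would give interference 0).\<close>

definition sinr :: "real \<Rightarrow> real \<Rightarrow> real \<Rightarrow> real \<Rightarrow> real \<Rightarrow> nat \<Rightarrow> nat set
    \<Rightarrow> (nat \<Rightarrow> real) \<Rightarrow> (nat \<Rightarrow> real) \<Rightarrow> real \<Rightarrow> real \<Rightarrow> ennreal" where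
  "sinr \<alpha> P_d P_c N0 r_d i \<Phi> h d h_c d_c =
     ennreal (P_d * h i * r_d powr (-\<alpha>)) /
     ((\<Sum>\<^sub>\<infinity>j\<in>\<Phi> - {i}. ennreal (P_d * h j * d j powr (-\<alpha>)))
        + ennreal (P_c * h_c * d_c powr (-\<alpha>)) + ennreal N0)"

definition outage_prob :: "'a measure \<Rightarrow> ('a \<Rightarrow> ennreal) \<Rightarrow> real \<Rightarrow> real" where
  "outage_prob M \<Gamma> \<gamma> = measure M {\<omega> \<in> space M. \<Gamma> \<omega> < ennreal \<gamma>}"

definition disk_distance_density :: "real \<Rightarrow> real \<Rightarrow> real" where
  "disk_distance_density R r =
     (if 0 \<le> r \<and> r \<le> 2 * R
      then 2 * r / R^2 * (2 / pi * arccos (r / (2 * R))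
                          - r / (pi * R) * sqrt (1 - r^2 / (4 * R^2)))
      else 0)"

definition O1_ATP :: "real \<Rightarrow> real \<Rightarrow> real \<Rightarrow> real \<Rightarrow> real \<Rightarrow> real \<Rightarrow> real" where
  "O1_ATP \<alpha> P_d P_c r_d R \<gamma> =
     (LBINT r:{0..2*R}. 1 / (1 + \<gamma> * P_c * r powr (-\<alpha>) / (P_d * r_d powr (-\<alpha>)))
                          * disk_distance_density R r)"

definition cheb_node :: "nat \<Rightarrow> nat \<Rightarrow> real" where
  "cheb_node K k = cos ((2 * real k - 1) / (2 * real K) * pi)"

definition O1_ATP_quadrature ::
    "real \<Rightarrow> real \<Rightarrow> real \<Rightarrow> real \<Rightarrow> real \<Rightarrow> real \<Rightarrow> nat \<Rightarrow> real" where
  "O1_ATP_quadrature \<alpha> P_d P_c r_d R \<gamma> K =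
     R * pi / real K *
       (\<Sum>k=1..K. let x = cheb_node K k; b = R * x + R in
          sqrt (1 - x^2) / (1 + \<gamma> * P_c * b powr (-\<alpha>) / (P_d * r_d powr (-\<alpha>)))
            * disk_distance_density R b)"

end

theory Submission
  imports Defs
begin

text \<open>
  The difference \<open>Z = U - Y\<close> of two independent uniform points of a disk of radius \<open>R\<close> has
  density proportional to the area of the lens \<open>D \<inter> (D - z)\<close>, where \<open>D\<close> is the disk; this area
  depends only on \<open>|z|\<close>, and \<open>|z|\<close> pushes planar Lebesgue measure forward to \<open>2 \<pi> r dr\<close>.
  For the outage probability, the SINR is at least \<open>\<gamma>\<close> iff the exponential gain of the desired
  link exceeds a constant times the total interference. Conditioning on everything else, this
  has probability \<open>exp (-)\<close> of that multiple, which factors over noise, cellular user and D2D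
  interferers; the cellular gain is integrated out by its Laplace transform \<open>1 / (1 + s)\<close>.
  With \<open>x = cos \<theta>\<close> the Gauss-Chebyshev sums are midpoint Riemann sums on \<open>[0, \<pi>]\<close>.
\<close>

section \<open>The distance between two uniform points of a disk\<close>

text \<open>Path loss exponents \<alpha> \<le> 2 are allowed, so the interference and its exponent
  may be infinite. The probability of coverage is therefore computed in \<open>ennreal\<close>, with
  \<open>exp_neg\<close> as the tail of a unit exponential extended by 0 at infinity, and brought
  back to the reals at the end. The mean over the D2D interferers enters through the assumed
  interference identity; what remains of it is the Laplace transform in its exponent and the
  substitution v = r^2. Two degenerate points need care: a vanishing SINR denominator, which has
  probability 0 because the cellular gain and distance have densities, and r = 0 in the integrand of
  \<open>O1_ATP\<close>, where \<open>powr\<close> makes the cellular factor jump while the density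
  vanishes.\<close>

lemma nn_integral_lborel_pair_slices:
  fixes f :: "'a::euclidean_space \<times> 'b::euclidean_space \<Rightarrow> ennreal"
  assumes [measurable]: "f \<in> borel_measurable borel"
  shows "(\<integral>\<^sup>+z. f z \<partial>lborel) = (\<integral>\<^sup>+y. \<integral>\<^sup>+x. f (x, y) \<partial>lborel \<partial>lborel)"
    and "(\<integral>\<^sup>+z. f z \<partial>lborel) = (\<integral>\<^sup>+x. \<integral>\<^sup>+y. f (x, y) \<partial>lborel \<partial>lborel)"
proof -
  have f: "f \<in> borel_measurable (lborel \<Otimes>\<^sub>M lborel)"
    by (simp add: lborel_prod)
  have "(\<integral>\<^sup>+z. f z \<partial>lborel) = (\<integral>\<^sup>+z. f z \<partial>(lborel \<Otimes>\<^sub>M lborel))"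
    by (simp add: lborel_prod)
  then show "(\<integral>\<^sup>+z. f z \<partial>lborel) = (\<integral>\<^sup>+y. \<integral>\<^sup>+x. f (x, y) \<partial>lborel \<partial>lborel)"
    and "(\<integral>\<^sup>+z. f z \<partial>lborel) = (\<integral>\<^sup>+x. \<integral>\<^sup>+y. f (x, y) \<partial>lborel \<partial>lborel)"
    using lborel_pair.nn_integral_snd[of f] lborel.nn_integral_fst[of f] f by (simp_all add: case_prod_unfold)
qed

lemma nn_integral_lborel_translate:
  fixes f :: "'a::euclidean_space \<Rightarrow> ennreal"
  assumes [measurable]: "f \<in> borel_measurable borel"
  shows "(\<integral>\<^sup>+x. f (c + x) \<partial>lborel) = (\<integral>\<^sup>+x. f x \<partial>lborel)"
  by (subst (2) lborel_distr_plus[of c, symmetric]) (simp add: nn_integral_distr)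

text \<open>On each line parallel to the sheared axis the map is a translation, so Tonelli reduces
  the claim to translation invariance in one dimension.\<close>

lemma nn_integral_lborel_shear:
  fixes f :: "real \<times> real \<Rightarrow> ennreal"
  assumes [measurable]: "f \<in> borel_measurable borel"
  shows "(\<integral>\<^sup>+z. f (fst z + t * snd z, snd z) \<partial>lborel) = (\<integral>\<^sup>+z. f z \<partial>lborel)"
    and "(\<integral>\<^sup>+z. f (fst z, snd z + t * fst z) \<partial>lborel) = (\<integral>\<^sup>+z. f z \<partial>lborel)"
proof -
  have [measurable]: "(\<lambda>z. f (fst z + t * snd z, snd z)) \<in> borel_measurable borel"
    "(\<lambda>z. f (fst z, snd z + t * fst z)) \<in> borel_measurable borel"
    by (rule measurable_compose[OF _ assms], intro borel_measurable_continuous_onI continuous_intros)+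
  have [measurable]: "(\<lambda>x. f (x, y)) \<in> borel_measurable borel" "(\<lambda>x. f (y, x)) \<in> borel_measurable borel" for y
    by (rule measurable_compose[OF _ assms], intro borel_measurable_continuous_onI continuous_intros)+
  show "(\<integral>\<^sup>+z. f (fst z + t * snd z, snd z) \<partial>lborel) = (\<integral>\<^sup>+z. f z \<partial>lborel)"
    using nn_integral_lborel_translate[of "\<lambda>x. f (x, y)" "t * y" for y]
    by (simp add: nn_integral_lborel_pair_slices(1) add.commute)
  show "(\<integral>\<^sup>+z. f (fst z, snd z + t * fst z) \<partial>lborel) = (\<integral>\<^sup>+z. f z \<partial>lborel)"
    using nn_integral_lborel_translate[of "\<lambda>x. f (y, x)" "t * y" for y]
    by (simp add: nn_integral_lborel_pair_slices(2) add.commute)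
qed

text \<open>A rotation by an angle other than \<open>\<pi>\<close> is a composition of three shears.\<close>

lemma nn_integral_lborel_rotate:
  fixes f :: "real \<times> real \<Rightarrow> ennreal"
  assumes [measurable]: "f \<in> borel_measurable borel"
    and cs: "c\<^sup>2 + s\<^sup>2 = 1" "c \<noteq> -1"
  shows "(\<integral>\<^sup>+z. f (c * fst z - s * snd z, s * fst z + c * snd z) \<partial>lborel) = (\<integral>\<^sup>+z. f z \<partial>lborel)"
proof -
  \<comment> \<open>For c = cos \<theta> and s = sin \<theta> this is t = -tan(\<theta>/2), and the
    rotation is the horizontal shear by t, the vertical shear by s and the horizontal shear by t
    again. The half turn c = -1 is the one angle where t is undefined.\<close>
  define t where "t = - s / (1 + c)"
  have nz: "1 + c \<noteq> 0" using cs(2) by linarith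
  have s2: "s * s = (1 - c) * (1 + c)"
    using cs(1) by (simp add: power2_eq_square algebra_simps)
  have 1: "1 + s * t = c"
    using nz s2 by (simp add: t_def field_simps)
  have 2: "t * (1 + c) = - s"
    using nz by (simp add: t_def)
  have m: "(\<lambda>z. f (fst z + t * snd z, snd z)) \<in> borel_measurable borel"
    "(\<lambda>z. f (fst z + t * (snd z + s * fst z), snd z + s * fst z)) \<in> borel_measurable borel"
    by (rule measurable_compose[OF _ assms(1)], intro borel_measurable_continuous_onI continuous_intros)+
  have "(x + t * y) + t * (y + s * (x + t * y)) = c * x - s * y"
    and "y + s * (x + t * y) = s * x + c * y" for x y
  proof -
    show *: "y + s * (x + t * y) = s * x + c * y"
      using 1 by (simp add: algebra_simps flip: 1)
    show "(x + t * y) + t * (y + s * (x + t * y)) = c * x - s * y"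
    proof -
      have "(x + t * y) + t * (s * x + c * y) = (1 + s * t) * x + (t * (1 + c)) * y"
        by (simp add: algebra_simps)
      then show ?thesis unfolding * 1 2 by simp
    qed
  qed
  then have "(\<integral>\<^sup>+z. f (c * fst z - s * snd z, s * fst z + c * snd z) \<partial>lborel)
    = (\<integral>\<^sup>+z. f (fst z + t * snd z + t * (snd z + s * (fst z + t * snd z)), snd z + s * (fst z + t * snd z)) \<partial>lborel)"
    by simp
  also have "\<dots> = (\<integral>\<^sup>+z. f (fst z + t * (snd z + s * fst z), snd z + s * fst z) \<partial>lborel)"
    using nn_integral_lborel_shear(1)[OF m(2), of t] by simp
  also have "\<dots> = (\<integral>\<^sup>+z. f (fst z + t * snd z, snd z) \<partial>lborel)"
    using nn_integral_lborel_shear(2)[OF m(1), of s] by simp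
  also have "\<dots> = (\<integral>\<^sup>+z. f z \<partial>lborel)"
    by (rule nn_integral_lborel_shear(1)) fact
  finally show ?thesis .
qed

section \<open>Polar coordinates in the plane\<close>

text \<open>Both measures give \<open>{..a}\<close> the mass pi a^2 for a \<ge> 0 and 0 otherwise,
  one by the area of a disk, the other by the antiderivative pi r^2. Half-lines are stable under
  intersection and generate the Borel sets.\<close>

lemma distr_norm_lborel_plane:
  "distr lborel borel (norm :: real \<times> real \<Rightarrow> real) =
    density lborel (\<lambda>r. ennreal (2 * pi * r) * indicator {0..} r)"
proof (rule measure_eqI_generator_eq[where E = "range atMost" and \<Omega> = UNIV and A = "\<lambda>n. {..real n}"])
  show "Int_stable (range atMost :: real set set)"
    by (auto simp: Int_stable_def)
  have e: "emeasure (distr lborel borel (norm :: real \<times> real \<Rightarrow> real)) {..a} =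
      ennreal (if a \<ge> 0 then pi * a\<^sup>2 else 0)" for a
  proof -
    have "emeasure (distr lborel borel (norm :: real \<times> real \<Rightarrow> real)) {..a} = emeasure lborel (cball (0::real\<times>real) a)"
      by (subst emeasure_distr) (auto intro!: arg_cong[where f = "emeasure lborel"])
    then show ?thesis
      by (cases "a \<ge> 0") (auto simp: emeasure_cball unit_ball_vol_2 cball_empty power2_eq_square)
  qed
  show "emeasure (distr lborel borel (norm :: real \<times> real \<Rightarrow> real)) {..real i} \<noteq> \<infinity>" for i
    by (simp add: e)
  show "emeasure (distr lborel borel (norm :: real \<times> real \<Rightarrow> real)) X =
    emeasure (density lborel (\<lambda>r. ennreal (2 * pi * r) * indicator {0..} r)) X"
    if "X \<in> range atMost" for X
  proof -
    from that obtain a where X: "X = {..a}" by auto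
    have "emeasure (density lborel (\<lambda>r. ennreal (2 * pi * r) * indicator {0..} r)) X =
      (\<integral>\<^sup>+r. ennreal (2 * pi * r) * indicator {0..a} r \<partial>lborel)"
      by (subst emeasure_density) (auto simp: X intro!: nn_integral_cong split: split_indicator)
    also have "\<dots> = ennreal (if a \<ge> 0 then pi * a\<^sup>2 else 0)"
    proof (cases "a \<ge> 0")
      case True
      have "(\<integral>\<^sup>+r. ennreal (2 * pi * r) * indicator {0..a} r \<partial>lborel) = ennreal (pi * a\<^sup>2 - pi * 0\<^sup>2)"
        using True by (intro nn_integral_FTC_Icc) (auto intro!: derivative_eq_intros)
      then show ?thesis using True by simp
    qed simp
    finally show ?thesis using X e by simp
  qed
  show "sets (distr lborel borel (norm :: real \<times> real \<Rightarrow> real)) = sigma_sets UNIV (range atMost)"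
    "sets (density lborel (\<lambda>r. ennreal (2 * pi * r) * indicator {0..} r)) = sigma_sets UNIV (range atMost :: real set set)"
    using arg_cong[OF borel_eq_atMost[where 'a = real], of sets] by auto
  show "(\<Union>i. {..real i}) = UNIV"
    using real_arch_simple by auto
qed auto

lemma nn_integral_radial_plane:
  fixes g :: "real \<Rightarrow> ennreal"
  assumes [measurable]: "g \<in> borel_measurable borel"
  shows "(\<integral>\<^sup>+z. g (norm (z :: real \<times> real)) \<partial>lborel) =
    (\<integral>\<^sup>+r. ennreal (2 * pi * r) * indicator {0..} r * g r \<partial>lborel)"
proof -
  have "(\<integral>\<^sup>+z. g (norm (z :: real \<times> real)) \<partial>lborel) = (\<integral>\<^sup>+r. g r \<partial>distr lborel borel (norm :: real \<times> real \<Rightarrow> real))"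
    by (simp add: nn_integral_distr)
  also have "\<dots> = (\<integral>\<^sup>+r. ennreal (2 * pi * r) * indicator {0..} r * g r \<partial>lborel)"
    unfolding distr_norm_lborel_plane by (subst nn_integral_density) auto
  finally show ?thesis .
qed


section \<open>The area of the lens\<close>

text \<open>At height y the disk is the chord [-s, s] with s = sqrt(R^2 - y^2), and the disk shifted
  by (-r, 0) is the chord [-s - r, s - r]. For r > 0 they meet in [-s, s - r], of length 2s - r if
  this is nonnegative.\<close>

lemma lens_slice_area:
  fixes r R :: real
  assumes "0 < R" "0 < r"
  shows "(\<integral>\<^sup>+x. indicator (cball 0 R) (x, y) * indicator (cball 0 R) ((r, 0) + (x, y)) \<partial>lborel)
    = ennreal (2 * sqrt (R\<^sup>2 - y\<^sup>2) - r)"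
proof -
  have cb: "(x, y) \<in> cball 0 R \<longleftrightarrow> y\<^sup>2 \<le> R\<^sup>2 \<and> \<bar>x\<bar> \<le> sqrt (R\<^sup>2 - y\<^sup>2)" for x :: real
  proof -
    have "(x, y) \<in> cball 0 R \<longleftrightarrow> sqrt (x\<^sup>2 + y\<^sup>2) \<le> R"
      by (simp add: norm_prod_def)
    also have "\<dots> \<longleftrightarrow> x\<^sup>2 + y\<^sup>2 \<le> R\<^sup>2"
      using assms by (metis abs_of_pos real_sqrt_abs real_sqrt_le_iff)
    also have "\<dots> \<longleftrightarrow> y\<^sup>2 \<le> R\<^sup>2 \<and> \<bar>x\<bar> \<le> sqrt (R\<^sup>2 - y\<^sup>2)"
    proof -
      have "\<bar>x\<bar> \<le> sqrt (R\<^sup>2 - y\<^sup>2) \<longleftrightarrow> x\<^sup>2 \<le> R\<^sup>2 - y\<^sup>2"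
        by (metis abs_ge_zero real_sqrt_abs real_sqrt_le_iff)
      then show ?thesis
        by (auto simp: algebra_simps) (smt (verit) zero_le_power2)
    qed
    finally show ?thesis .
  qed
  show ?thesis
  proof (cases "y\<^sup>2 \<le> R\<^sup>2")
    case True
    define s where "s = sqrt (R\<^sup>2 - y\<^sup>2)"
    have s: "0 \<le> s" using True by (simp add: s_def)
    have "(\<integral>\<^sup>+x. indicator (cball 0 R) (x, y) * indicator (cball 0 R) ((r, 0) + (x, y)) \<partial>lborel)
      = (\<integral>\<^sup>+x. indicator {-s..s - r} x \<partial>lborel)"
    proof (intro nn_integral_cong)
      fix x
      have "(x, y) \<in> cball 0 R \<and> (r, 0) + (x, y) \<in> cball 0 R \<longleftrightarrow> x \<in> {-s..s - r}"
        unfolding add_Pair add_0 cb s_def[symmetric] using True assms s by auto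
      then show "indicator (cball 0 R) (x, y) * indicator (cball 0 R) ((r, 0) + (x, y)) =
          (indicator {-s..s - r} x :: ennreal)"
        by (auto simp: indicator_def simp del: mem_cball mem_cball_0)
    qed
    also have "\<dots> = ennreal (2 * s - r)"
      by (simp add: emeasure_lborel_Icc_eq) (simp add: ennreal_neg)
    finally show ?thesis by (simp add: s_def)
  next
    case False
    then have "sqrt (R\<^sup>2 - y\<^sup>2) \<le> 0" by simp
    then have "2 * sqrt (R\<^sup>2 - y\<^sup>2) - r \<le> 0" using assms by linarith
    moreover have "indicator (cball 0 R) (x, y) = (0 :: ennreal)" for x :: real
      using False cb[of x] by (auto simp: indicator_def simp del: mem_cball mem_cball_0)
    ultimately show ?thesis by (simp only: mult_zero_left ennreal_neg nn_integral_const mult_zero_left)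
  qed
qed

text \<open>No truncation of the slices is needed: \<open>ennreal\<close> maps negative lengths to 0, and Isabelle's
  \<open>sqrt\<close> is negative on negative arguments.\<close>

lemma nn_integral_lens_slices:
  fixes r R :: real
  assumes R: "0 < R" and r: "0 < r"
  shows "(\<integral>\<^sup>+y. ennreal (2 * sqrt (R\<^sup>2 - y\<^sup>2) - r) \<partial>lborel)
    = ennreal (if r \<le> 2 * R then 2 * R\<^sup>2 * arccos (r / (2 * R)) - r * sqrt (R\<^sup>2 - (r / 2)\<^sup>2) else 0)"
proof (cases "r < 2 * R")
  case True
  \<comment> \<open>m is half the height of the lens: the slice at y is nonempty iff |y| \<le>
    m.\<close>
  define m where "m = sqrt (R\<^sup>2 - (r / 2)\<^sup>2)"
  have r2: "(r / 2)\<^sup>2 < R\<^sup>2" using True r by (intro power_strict_mono) auto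
  have m2: "m\<^sup>2 = R\<^sup>2 - (r / 2)\<^sup>2" and m0: "0 < m"
    using r2 by (simp_all add: m_def)
  have nonneg: "2 * sqrt (R\<^sup>2 - y\<^sup>2) - r \<ge> 0 \<longleftrightarrow> \<bar>y\<bar> \<le> m" for y
  proof -
    have "2 * sqrt (R\<^sup>2 - y\<^sup>2) - r \<ge> 0 \<longleftrightarrow> sqrt ((r / 2)\<^sup>2) \<le> sqrt (R\<^sup>2 - y\<^sup>2)"
      using r by auto
    also have "\<dots> \<longleftrightarrow> y\<^sup>2 \<le> m\<^sup>2" unfolding real_sqrt_le_iff m2 by auto
    finally show "2 * sqrt (R\<^sup>2 - y\<^sup>2) - r \<ge> 0 \<longleftrightarrow> \<bar>y\<bar> \<le> m"
      using m0 by (metis abs_of_pos real_sqrt_abs real_sqrt_le_iff)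
  qed
  define F where "F y = y * sqrt (R\<^sup>2 - y\<^sup>2) + R\<^sup>2 * arcsin (y / R) - r * y" for y
  \<comment> \<open>Since r > 0, the chord length stays positive up to the endpoints, so |y| < R and
    neither the root nor \<open>arcsin\<close> is differentiated at a singular point.\<close>
  have F': "(F has_real_derivative (2 * sqrt (R\<^sup>2 - y\<^sup>2) - r)) (at y)" if "y \<in> {-m..m}" for y
  proof -
    define q where "q = sqrt (R\<^sup>2 - y\<^sup>2)"
    have "2 * q - r \<ge> 0" using nonneg[of y] that by (auto simp: q_def)
    then have q: "q > 0" using r by linarith
    then have y2: "y\<^sup>2 < R\<^sup>2" by (simp add: q_def)
    then have yR: "\<bar>y\<bar> < R" using R by (metis abs_of_pos real_sqrt_abs real_sqrt_less_iff)
    have q2: "q\<^sup>2 = R\<^sup>2 - y\<^sup>2" using y2 by (simp add: q_def)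
    have "1 - (y / R)\<^sup>2 = (q / R)\<^sup>2"
      using R q2 by (simp add: power_divide field_simps)
    then have sq: "sqrt (1 - (y / R)\<^sup>2) = q / R"
      using R q by (metis abs_of_pos divide_pos_pos real_sqrt_abs)
    have d1: "((\<lambda>y. sqrt (R\<^sup>2 - y\<^sup>2)) has_real_derivative inverse q / 2 * (- (2 * y))) (at y)"
      unfolding q_def using y2
      by (intro DERIV_chain2[OF DERIV_real_sqrt]) (auto intro!: derivative_eq_intros)
    have "((\<lambda>y. arcsin (y / R)) has_real_derivative inverse (sqrt (1 - (y / R)\<^sup>2)) * (1 / R)) (at y)"
      using yR R
      by (intro DERIV_chain2[OF DERIV_arcsin]) (auto intro!: derivative_eq_intros simp: field_simps abs_less_iff)
    then have d2: "((\<lambda>y. arcsin (y / R)) has_real_derivative inverse (q / R) * (1 / R)) (at y)"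
      unfolding sq .
    have "(F has_real_derivative ((1 * sqrt (R\<^sup>2 - y\<^sup>2) + (inverse q / 2 * (- (2 * y))) * y)
        + R\<^sup>2 * (inverse (q / R) * (1 / R)) - r * 1)) (at y)"
      unfolding F_def by (intro DERIV_diff DERIV_add DERIV_mult DERIV_cmult DERIV_ident d1 d2)
    moreover have "(1 * sqrt (R\<^sup>2 - y\<^sup>2) + (inverse q / 2 * (- (2 * y))) * y)
        + R\<^sup>2 * (inverse (q / R) * (1 / R)) - r * 1 = 2 * q - r"
    proof -
      have "(inverse q / 2 * (- (2 * y))) * y + R\<^sup>2 * (inverse (q / R) * (1 / R)) = (R\<^sup>2 - y\<^sup>2) / q"
        using q R by (simp add: field_simps power2_eq_square)
      also have "\<dots> = q" unfolding q2[symmetric] using q by (simp add: power2_eq_square)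
      finally show ?thesis by (simp add: q_def)
    qed
    ultimately show ?thesis unfolding q_def[symmetric] by (simp only:)
  qed
  have "(\<integral>\<^sup>+y. ennreal (2 * sqrt (R\<^sup>2 - y\<^sup>2) - r) \<partial>lborel)
    = (\<integral>\<^sup>+y. ennreal (2 * sqrt (R\<^sup>2 - y\<^sup>2) - r) * indicator {-m..m} y \<partial>lborel)"
  proof (intro nn_integral_cong)
    fix y
    show "ennreal (2 * sqrt (R\<^sup>2 - y\<^sup>2) - r) = ennreal (2 * sqrt (R\<^sup>2 - y\<^sup>2) - r) * indicator {-m..m} y"
      using nonneg[of y] by (cases "\<bar>y\<bar> \<le> m") (auto simp: abs_le_iff not_le ennreal_neg indicator_def)
  qed
  also have "\<dots> = ennreal (F m - F (-m))"
    using F' nonneg m0 by (intro nn_integral_FTC_Icc) (auto simp: abs_le_iff)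
  also have "F m - F (-m) = 2 * R\<^sup>2 * arcsin (m / R) - r * m"
  proof -
    have "sqrt (R\<^sup>2 - m\<^sup>2) = r / 2" using m2 r by (simp add: real_sqrt_unique)
    moreover have "m \<le> R"
      unfolding m_def using R by (intro real_le_lsqrt) auto
    then have "-1 \<le> m / R" "m / R \<le> 1"
      using m0 R by (auto simp: field_simps)
    then have "arcsin (- m / R) = - arcsin (m / R)"
      using arcsin_minus[of "m / R"] by simp
    ultimately show ?thesis
      by (simp add: F_def field_simps)
  qed
  \<comment> \<open>m and r/2 are the legs of a right triangle with hypotenuse R, and both sides are
    the same angle; r > 0 keeps the arccos in [0, pi/2].\<close>
  also have "arcsin (m / R) = arccos (r / (2 * R))"
  proof -
    have "sin (arccos (r / (2 * R))) = sqrt (1 - (r / (2 * R))\<^sup>2)"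
      using r R True by (intro sin_arccos_abs) (auto simp: field_simps)
    also have "\<dots> = sqrt ((R\<^sup>2 - (r / 2)\<^sup>2) / R\<^sup>2)"
      using R by (simp add: field_simps)
    also have "\<dots> = m / R" using R by (simp add: real_sqrt_divide m_def)
    finally have "m / R = sin (arccos (r / (2 * R)))" by simp
    moreover have "0 \<le> arccos (r / (2 * R))" "arccos (r / (2 * R)) \<le> pi / 2"
      using r R True arccos_lbound[of "r / (2 * R)"] arccos_le_pi2[of "r / (2 * R)"]
      by (simp_all add: order_trans[of "-1" 0])
    ultimately show ?thesis by (simp add: arcsin_sin)
  qed
  finally show ?thesis using True by (simp add: m_def)
next
  case False
  have "2 * sqrt (R\<^sup>2 - y\<^sup>2) - r \<le> 0" for y
  proof -
    have "sqrt (R\<^sup>2 - y\<^sup>2) \<le> sqrt (R\<^sup>2)" unfolding real_sqrt_le_iff by simp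
    then show ?thesis using False R by simp
  qed
  then have "(\<integral>\<^sup>+y. ennreal (2 * sqrt (R\<^sup>2 - y\<^sup>2) - r) \<partial>lborel) = 0"
    by (simp add: ennreal_neg)
  \<comment> \<open>At r = 2R the closed formula still applies and gives 0, since arccos 1 = 0 and
    the root vanishes.\<close>
  moreover have "r / (2 * R) = 1" "r / 2 = R" if "r = 2 * R" using that R by auto
  ultimately show ?thesis using False by (auto simp: power2_eq_square)
qed


text \<open>The disk is invariant under rotations, so z may be turned onto the positive horizontal
  axis, where the slices are known. The rotation formula excludes the half turn, so this is done for
  z in the right half plane; translation by -z swaps the lenses of z and -z and covers the
  rest.\<close>

lemma lens_area_radial:
  fixes z :: "real \<times> real"
  assumes R: "0 < R" and z: "z \<noteq> 0"
  shows "(\<integral>\<^sup>+y. indicator (cball 0 R) y * indicator (cball 0 R) (z + y) \<partial>lborel) =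
    (\<integral>\<^sup>+y. ennreal (2 * sqrt (R\<^sup>2 - y\<^sup>2) - norm z) \<partial>lborel)"
proof -
  define D :: "real \<times> real \<Rightarrow> ennreal" where "D = indicator (cball 0 R)"
  have [measurable]: "D \<in> borel_measurable borel"
    unfolding D_def by (intro borel_measurable_indicator) simp
  have right: "(\<integral>\<^sup>+y. D y * D (z + y) \<partial>lborel) =
    (\<integral>\<^sup>+y. ennreal (2 * sqrt (R\<^sup>2 - y\<^sup>2) - norm z) \<partial>lborel)"
    if z: "z \<noteq> 0" "0 \<le> fst z" for z :: "real \<times> real"
  proof -
    define r c s where "r = norm z" and "c = fst z / r" and "s = snd z / r"
    have r: "r > 0" using z by (simp add: r_def)
    have r2: "r\<^sup>2 = (fst z)\<^sup>2 + (snd z)\<^sup>2"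
      by (cases z) (simp add: r_def norm_prod_def)
    have cs: "c\<^sup>2 + s\<^sup>2 = 1"
      using r by (simp add: c_def s_def power_divide r2 add_divide_distrib[symmetric] flip: r2)
    have c: "0 \<le> c" using z r by (simp add: c_def)
    have zcs: "z = (c * r, s * r)" using r by (simp add: c_def s_def prod_eq_iff)
    define T where "T w = (c * fst w - s * snd w, s * fst w + c * snd w)" for w :: "real \<times> real"
    have norm_T: "norm (T w) = norm w" for w
    proof -
      have "(c * x - s * y)\<^sup>2 + (s * x + c * y)\<^sup>2 = (c\<^sup>2 + s\<^sup>2) * (x\<^sup>2 + y\<^sup>2)" for x y
        by (simp add: power2_eq_square algebra_simps)
      then show ?thesis by (cases w) (simp add: T_def norm_prod_def cs)
    qed
    have T_add: "z + T w = T ((r, 0) + w)" for w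
      by (cases w) (simp add: T_def zcs algebra_simps)
    have [measurable]: "(\<lambda>y. D y * D (z + y)) \<in> borel_measurable borel" by measurable
    have "(\<integral>\<^sup>+y. D y * D (z + y) \<partial>lborel) =
      (\<integral>\<^sup>+w. D (T w) * D (z + T w) \<partial>lborel)"
      unfolding T_def using cs c
      by (subst nn_integral_lborel_rotate[of "\<lambda>y. D y * D (z + y)"]) auto
    also have "\<dots> = (\<integral>\<^sup>+w. D w * D ((r, 0) + w) \<partial>lborel)"
      unfolding T_add by (simp add: D_def indicator_def norm_T)
    also have "\<dots> = (\<integral>\<^sup>+y. \<integral>\<^sup>+x. D (x, y) * D ((r, 0) + (x, y)) \<partial>lborel \<partial>lborel)"
      by (subst nn_integral_lborel_pair_slices(1)) auto
    also have "\<dots> = (\<integral>\<^sup>+y. ennreal (2 * sqrt (R\<^sup>2 - y\<^sup>2) - r) \<partial>lborel)"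
      using lens_slice_area[OF R r] by (simp add: D_def)
    finally show ?thesis by (simp add: r_def)
  qed
  show ?thesis
  proof (cases "0 \<le> fst z")
    case True
    then show ?thesis using right z unfolding D_def by blast
  next
    case False
    have "(\<integral>\<^sup>+y. D y * D (z + y) \<partial>lborel)
      = (\<integral>\<^sup>+y. D (- z + y) * D (z + (- z + y)) \<partial>lborel)"
      by (rule nn_integral_lborel_translate[symmetric, of "\<lambda>y. D y * D (z + y)"]) measurable
    also have "\<dots> = (\<integral>\<^sup>+y. D y * D (- z + y) \<partial>lborel)"
      by (simp add: mult.commute)
    also have "\<dots> = (\<integral>\<^sup>+y. ennreal (2 * sqrt (R\<^sup>2 - y\<^sup>2) - norm z) \<partial>lborel)"
      using right[of "- z"] z False by simp
    finally show ?thesis unfolding D_def .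
  qed
qed

section \<open>From lens areas to the density\<close>

lemma continuous_on_disk_distance_density:
  assumes "0 < R"
  shows "continuous_on {0..2 * R} (disk_distance_density R)"
proof -
  have "continuous_on {0..2 * R} (\<lambda>r. 2 * r / R\<^sup>2 * (2 / pi * arccos (r / (2 * R))
      - r / (pi * R) * sqrt (1 - r\<^sup>2 / (4 * R\<^sup>2))))"
    using assms by (intro continuous_intros) (auto simp: field_simps)
  then show ?thesis
    by (rule continuous_on_eq) (auto simp: disk_distance_density_def)
qed

lemma borel_measurable_disk_distance_density:
  assumes "0 < R"
  shows "disk_distance_density R \<in> borel_measurable borel"
proof -
  have "(\<lambda>r. if r \<in> {0..2 * R} then disk_distance_density R r else 0) \<in> borel_measurable borel"
    using assms by (intro borel_measurable_continuous_on_if continuous_on_disk_distance_density) auto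
  moreover have "(\<lambda>r. if r \<in> {0..2 * R} then disk_distance_density R r else 0) = disk_distance_density R"
    by (auto simp: disk_distance_density_def)
  ultimately show ?thesis by simp
qed

text \<open>Lens area times the polar weight 2 pi r is the density of the distance before
  normalisation; the constant (pi R^2)^2 comes from the two uniform laws, each of density 1/(pi
  R^2).\<close>

lemma lens_area_eq_disk_distance_density:
  assumes R: "0 < R" and r: "0 < r"
  shows "2 * pi * r * (if r \<le> 2 * R then 2 * R\<^sup>2 * arccos (r / (2 * R)) - r * sqrt (R\<^sup>2 - (r / 2)\<^sup>2) else 0)
    = (pi * R\<^sup>2)\<^sup>2 * disk_distance_density R r"
proof (cases "r \<le> 2 * R")
  case True
  have "1 - r\<^sup>2 / (4 * R\<^sup>2) = (R\<^sup>2 - (r / 2)\<^sup>2) / R\<^sup>2"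
    using R by (simp add: field_simps)
  then have sq: "sqrt (1 - r\<^sup>2 / (4 * R\<^sup>2)) = sqrt (R\<^sup>2 - (r / 2)\<^sup>2) / R"
    using R by (simp add: real_sqrt_divide)
  have "2 * pi * r * (2 * R\<^sup>2 * A - r * q) =
      (pi * R\<^sup>2)\<^sup>2 * (2 * r / R\<^sup>2 * (2 / pi * A - r / (pi * R) * (q / R)))" for A q :: real
  proof -
    have "(pi * R\<^sup>2)\<^sup>2 * (2 * r / R\<^sup>2) = 2 * pi * r * (pi * R\<^sup>2)"
      using R by (simp add: power2_eq_square)
    moreover have "pi * R\<^sup>2 * (2 / pi * A - r / (pi * R) * (q / R)) = 2 * R\<^sup>2 * A - r * q"
      using R by (simp add: right_diff_distrib power2_eq_square)
    ultimately show ?thesis by (metis mult.assoc)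
  qed
  then show ?thesis
    using True r by (simp add: disk_distance_density_def sq)
qed (use r in \<open>simp add: disk_distance_density_def\<close>)

text \<open>For fixed y substitute u = y + z. After swapping the integrals, the inner one over y is
  the area of the lens of z, a function of \<open>norm z\<close> outside the null set z = 0, and
  polar coordinates finish.\<close>

lemma nn_integral_dist_disk:
  fixes g :: "real \<Rightarrow> ennreal" and R :: real
  assumes R: "0 < R" and g[measurable]: "g \<in> borel_measurable borel"
  shows "(\<integral>\<^sup>+(u :: real \<times> real). \<integral>\<^sup>+y. indicator (cball 0 R) u * indicator (cball 0 R) y * g (dist u y) \<partial>lborel \<partial>lborel) =
    ennreal ((pi * R\<^sup>2)\<^sup>2) * (\<integral>\<^sup>+r. ennreal (disk_distance_density R r) * g r \<partial>lborel)"
proof -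
  define D :: "real \<times> real \<Rightarrow> ennreal" where "D = indicator (cball 0 R)"
  have [measurable]: "D \<in> borel_measurable borel"
    unfolding D_def by (intro borel_measurable_indicator) simp
  note [measurable] = borel_measurable_disk_distance_density[OF R]
  \<comment> \<open>k is the lens area for r > 0, obtained by solving
    \<open>lens_area_eq_disk_distance_density\<close> for it; in this form it is measurable on the
    whole line. At r = 0 the weight 2 pi r removes whatever value it has.\<close>
  define k where "k r = (pi * R\<^sup>2)\<^sup>2 * disk_distance_density R r / (2 * pi * r)" for r
  have [measurable]: "k \<in> borel_measurable borel" unfolding k_def by measurable
  have "(\<integral>\<^sup>+u. \<integral>\<^sup>+y. D u * D y * g (dist u y) \<partial>lborel \<partial>lborel) =
      (\<integral>\<^sup>+(y::real \<times> real). \<integral>\<^sup>+u. D u * D y * g (dist u y) \<partial>lborel \<partial>lborel)"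
    by (rule lborel_pair.Fubini'[symmetric]) measurable
  also have "\<dots> = (\<integral>\<^sup>+y. \<integral>\<^sup>+z. D (y + z) * D y * g (norm z) \<partial>lborel \<partial>lborel)"
  proof (rule nn_integral_cong)
    fix y :: "real \<times> real"
    show "(\<integral>\<^sup>+u. D u * D y * g (dist u y) \<partial>lborel) = (\<integral>\<^sup>+z. D (y + z) * D y * g (norm z) \<partial>lborel)"
      by (subst nn_integral_lborel_translate[of "\<lambda>u. D u * D y * g (dist u y)" y, symmetric])
         (measurable, simp add: dist_norm)
  qed
  also have "\<dots> = (\<integral>\<^sup>+(z::real \<times> real). \<integral>\<^sup>+y. D (y + z) * D y * g (norm z) \<partial>lborel \<partial>lborel)"
    by (rule lborel_pair.Fubini'[symmetric]) measurable
  also have "\<dots> = (\<integral>\<^sup>+(z::real \<times> real). g (norm z) * (\<integral>\<^sup>+y. D y * D (z + y) \<partial>lborel) \<partial>lborel)"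
    by (subst nn_integral_cmult[symmetric]) (measurable, simp add: ac_simps)
  also have "\<dots> = (\<integral>\<^sup>+(z::real \<times> real). g (norm z) * ennreal (k (norm z)) \<partial>lborel)"
  proof (rule nn_integral_cong_AE)
    show "AE z :: real \<times> real in lborel. g (norm z) * (\<integral>\<^sup>+y. D y * D (z + y) \<partial>lborel) = g (norm z) * ennreal (k (norm z))"
      using AE_lborel_singleton[of 0]
    proof eventually_elim
      case (elim z)
      then have "norm z > 0" by simp
      then have "k (norm z) = (if norm z \<le> 2 * R then 2 * R\<^sup>2 * arccos (norm z / (2 * R))
          - norm z * sqrt (R\<^sup>2 - (norm z / 2)\<^sup>2) else 0)"

        unfolding k_def lens_area_eq_disk_distance_density[OF R \<open>norm z > 0\<close>, symmetric] by simp
      then show ?case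
        using lens_area_radial[OF R elim, folded D_def] nn_integral_lens_slices[OF R \<open>norm z > 0\<close>] by simp
    qed
  qed
  also have "\<dots> = (\<integral>\<^sup>+r. ennreal (2 * pi * r) * indicator {0..} r * (g r * ennreal (k r)) \<partial>lborel)"
    by (rule nn_integral_radial_plane) measurable
  also have "\<dots> = (\<integral>\<^sup>+r. ennreal ((pi * R\<^sup>2)\<^sup>2) * (ennreal (disk_distance_density R r) * g r) \<partial>lborel)"
  proof (rule nn_integral_cong)
    fix r :: real
    have "ennreal (2 * pi * r) * ennreal (k r) = ennreal ((pi * R\<^sup>2)\<^sup>2) * ennreal (disk_distance_density R r)"
      if "0 \<le> r"
    proof (cases "r = 0")
      case False
      then show ?thesis using that
        by (subst (1 2) ennreal_mult'[symmetric]) (auto simp: k_def)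
    qed (simp add: disk_distance_density_def)
    note eq = this
    show "ennreal (2 * pi * r) * indicator {0..} r * (g r * ennreal (k r)) =
        ennreal ((pi * R\<^sup>2)\<^sup>2) * (ennreal (disk_distance_density R r) * g r)"
    proof (cases "0 \<le> r")
      case True
      have "ennreal (2 * pi * r) * indicator {0..} r * (g r * ennreal (k r)) =
          (ennreal (2 * pi * r) * ennreal (k r)) * g r"
        using True by (simp add: mult.assoc mult.commute[of "g r"])
      then show ?thesis unfolding eq[OF True] by (simp add: mult.assoc)
    qed (simp add: disk_distance_density_def)
  qed
  also have "\<dots> = ennreal ((pi * R\<^sup>2)\<^sup>2) * (\<integral>\<^sup>+r. ennreal (disk_distance_density R r) * g r \<partial>lborel)"
    by (rule nn_integral_cmult) measurable
  finally show ?thesis unfolding D_def .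
qed


text \<open>Independence makes the joint law the product of two uniform laws. Testing it on
  indicators g of the distance gives the double integral over the disk, and the two normalisations
  by the disk area A cancel the factor A^2.\<close>

lemma distributed_dist_uniform_disk:
  fixes U Y :: "'a \<Rightarrow> point"
  assumes "prob_space M" and R: "0 < R"
    and U[measurable]: "U \<in> borel_measurable M" "distr M lborel U = uniform_measure lborel (cball 0 R)"
    and Y[measurable]: "Y \<in> borel_measurable M" "distr M lborel Y = uniform_measure lborel (cball 0 R)"
    and indep: "prob_space.indep_var M borel U borel Y"
  shows "distributed M lborel (\<lambda>\<omega>. dist (U \<omega>) (Y \<omega>)) (disk_distance_density R)"
proof -
  interpret prob_space M by fact
  note [measurable] = borel_measurable_disk_distance_density[OF R]
  let ?B = "cball 0 R :: point set" and ?D = "uniform_measure lborel (cball 0 R :: point set)"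
  define A where "A = ennreal (pi * R\<^sup>2)"
  define K :: "point \<Rightarrow> ennreal" where "K = indicator ?B"
  have [measurable]: "K \<in> borel_measurable borel"
    unfolding K_def by (intro borel_measurable_indicator) simp
  have area: "emeasure lborel ?B = A"
    using R by (simp add: A_def emeasure_cball unit_ball_vol_2 power2_eq_square)
  have A: "A \<noteq> 0" "A \<noteq> \<infinity>"
    using R by (auto simp: A_def)
  \<comment> \<open>\<open>lborel\<close> and \<open>borel\<close> have the same sets, so the laws
    assumed over the one can be combined with independence over the other.\<close>
  have "distr M borel X = distr M lborel X" for X :: "'a \<Rightarrow> point"
    by (intro distr_cong) auto
  then have distrs: "distr M borel U = ?D" "distr M borel Y = ?D"
    using U(2) Y(2) by simp_all
  interpret D: prob_space ?D
    using A by (intro prob_space_uniform_measure) (auto simp: area)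
  have joint: "distr M (borel \<Otimes>\<^sub>M borel) (\<lambda>\<omega>. (U \<omega>, Y \<omega>)) = ?D \<Otimes>\<^sub>M ?D"
    using indep unfolding indep_var_distribution_eq distrs by simp
  have "emeasure (distr M lborel (\<lambda>\<omega>. dist (U \<omega>) (Y \<omega>))) S = emeasure (density lborel (disk_distance_density R)) S"
    if "S \<in> sets borel" for S :: "real set"
  proof -
    define g :: "real \<Rightarrow> ennreal" where "g = indicator S"
    have [measurable]: "g \<in> borel_measurable borel"
      unfolding g_def using that by (intro borel_measurable_indicator) simp
    have "emeasure (distr M lborel (\<lambda>\<omega>. dist (U \<omega>) (Y \<omega>))) S = (\<integral>\<^sup>+r. g r \<partial>distr M lborel (\<lambda>\<omega>. dist (U \<omega>) (Y \<omega>)))"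
      using that by (simp add: g_def)
    also have "\<dots> = (\<integral>\<^sup>+\<omega>. g (dist (U \<omega>) (Y \<omega>)) \<partial>M)"
      by (subst nn_integral_distr) auto
    also have "\<dots> = (\<integral>\<^sup>+p. g (dist (fst p) (snd p)) \<partial>distr M (borel \<Otimes>\<^sub>M borel) (\<lambda>\<omega>. (U \<omega>, Y \<omega>)))"
      by (subst nn_integral_distr) auto
    also have "\<dots> = (\<integral>\<^sup>+u. \<integral>\<^sup>+y. g (dist u y) \<partial>?D \<partial>?D)"
      unfolding joint by (subst D.nn_integral_fst[symmetric]) auto
    also have "\<dots> = (\<integral>\<^sup>+u. (\<integral>\<^sup>+y. g (dist u y) * K y \<partial>lborel) / A \<partial>?D)"
      by (subst nn_integral_uniform_measure) (auto simp: area K_def)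
    also have "\<dots> = (\<integral>\<^sup>+u. (\<integral>\<^sup>+y. g (dist u y) * K y \<partial>lborel) / A * indicator ?B u \<partial>lborel) / A"
      unfolding area[symmetric] by (intro nn_integral_uniform_measure) measurable
    also have "\<dots> = (\<integral>\<^sup>+u. \<integral>\<^sup>+y. indicator ?B u * indicator ?B y * g (dist u y) \<partial>lborel \<partial>lborel) / A / A"
    proof -
      have "(\<integral>\<^sup>+y. g (dist u y) * K y \<partial>lborel) / A * indicator ?B u =
          (\<integral>\<^sup>+y. K u * K y * g (dist u y) \<partial>lborel) / A" for u
        by (auto simp: K_def mult.commute split: split_indicator)
      moreover have "(\<integral>\<^sup>+u. (\<integral>\<^sup>+y. K u * K y * g (dist u y) \<partial>lborel) / A \<partial>lborel) =
          (\<integral>\<^sup>+u. \<integral>\<^sup>+y. K u * K y * g (dist u y) \<partial>lborel \<partial>lborel) / A"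
        by (rule nn_integral_divide) measurable
      ultimately show ?thesis by (simp add: K_def)
    qed
    also have "\<dots> = ennreal ((pi * R\<^sup>2)\<^sup>2) * (\<integral>\<^sup>+r. ennreal (disk_distance_density R r) * g r \<partial>lborel) / A / A"
      by (subst nn_integral_dist_disk[OF R]) auto
    also have "ennreal ((pi * R\<^sup>2)\<^sup>2) = A * A"
      by (simp add: A_def power2_eq_square flip: ennreal_mult)
    also have "A * A * (\<integral>\<^sup>+r. ennreal (disk_distance_density R r) * g r \<partial>lborel) / A / A =
        (\<integral>\<^sup>+r. ennreal (disk_distance_density R r) * g r \<partial>lborel)"
    proof -
      have cancel: "x * A / A = x" for x :: ennreal
        using A by (simp add: ennreal_mult_divide_eq)
      have "A * A * x / A / A = (x * A) * A / A / A" for x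
        by (simp only: mult_ac)
      then show ?thesis unfolding cancel .
    qed
    also have "\<dots> = emeasure (density lborel (disk_distance_density R)) S"
      using that by (subst emeasure_density) (auto simp: g_def)
    finally show ?thesis .
  qed
  then have "distr M lborel (\<lambda>\<omega>. dist (U \<omega>) (Y \<omega>)) = density lborel (disk_distance_density R)"
    by (intro measure_eqI) auto
  then show ?thesis by (simp add: distributed_def)
qed

section \<open>Gauss-Chebyshev quadrature\<close>

lemma integral_equal_pieces:
  fixes G :: "real \<Rightarrow> real"
  assumes "continuous_on {0..real K * w} G" "0 \<le> w" "n \<le> K"
  shows "integral {0..real n * w} G = (\<Sum>k=1..n. integral {(real k - 1) * w..real k * w} G)"
  using assms(3)
proof (induction n)
  case (Suc n)
  have le: "real n * w \<le> real (Suc n) * w" "real (Suc n) * w \<le> real K * w"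
    using Suc.prems assms(2) by (intro mult_right_mono; simp)+
  have "integral {0..real (Suc n) * w} G =
      integral {0..real n * w} G + integral {real n * w..real (Suc n) * w} G"
    using le assms(2)
    by (intro Henstock_Kurzweil_Integration.integral_combine[symmetric] integrable_continuous_real continuous_on_subset[OF assms(1)]) auto
  then show ?case
    using Suc by simp
qed simp

text \<open>By uniform continuity each piece of width w < d contributes an error of at most e / (2
  b) times w, because its node lies in it; the errors add up to at most e / 2.\<close>

lemma midpoint_sums_tendsto_integral:
  fixes G :: "real \<Rightarrow> real"
  assumes G: "continuous_on {0..b} G" and b: "0 < b"
  shows "(\<lambda>K. b / real K * (\<Sum>k=1..K. G ((2 * real k - 1) / (2 * real K) * b)))
    \<longlonglongrightarrow> integral {0..b} G"
proof (rule LIMSEQ_I)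
  fix e :: real assume e: "0 < e"
  have "uniformly_continuous_on {0..b} G"
    using G by (intro compact_uniformly_continuous) auto
  moreover have e': "0 < e / (2 * b)" using e b by simp
  ultimately obtain d where d: "0 < d"
    and G_d: "\<And>x y. x \<in> {0..b} \<Longrightarrow> y \<in> {0..b} \<Longrightarrow> \<bar>y - x\<bar> < d \<Longrightarrow> \<bar>G y - G x\<bar> < e / (2 * b)"
    unfolding uniformly_continuous_on_def dist_real_def by metis
  obtain N :: nat where N: "b / d < real N" using reals_Archimedean2 by blast
  show "\<exists>no. \<forall>K\<ge>no. norm (b / real K * (\<Sum>k=1..K. G ((2 * real k - 1) / (2 * real K) * b)) - integral {0..b} G) < e"
  proof (intro exI[of _ "Suc N"] allI impI)
    fix K assume K: "Suc N \<le> K"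
    define w where "w = b / real K"
    define m where "m k = (2 * real k - 1) / (2 * real K) * b" for k
    have K0: "0 < real K" using K by simp
    have Kw: "real K * w = b" using K0 by (simp add: w_def)
    have w: "0 < w" using K0 b by (simp add: w_def)
    have "b / d < real K" using N K by linarith
    then have wd: "w < d" using d K0 by (simp add: w_def field_simps)
    have m: "m k = (real k - 1 / 2) * w" for k
      using K0 by (simp add: m_def w_def field_simps)
    have piece: "\<bar>w * G (m k) - integral {(real k - 1) * w..real k * w} G\<bar> \<le> e / (2 * b) * w"
      if k: "k \<in> {1..K}" for k
    proof -
      have len: "real k * w - (real k - 1) * w = w" by (simp add: algebra_simps)
      have "0 \<le> (real k - 1) * w" "real k * w \<le> real K * w"
        using k w by auto
      then have sub: "{(real k - 1) * w..real k * w} \<subseteq> {0..b}" using Kw by auto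
      have mk: "m k \<in> {(real k - 1) * w..real k * w}"
        using w unfolding m by (auto intro!: mult_right_mono)
      have cont: "continuous_on {(real k - 1) * w..real k * w} G"
        by (rule continuous_on_subset[OF G sub])
      have "integral {(real k - 1) * w..real k * w} (\<lambda>x. G (m k) - G x) =
          w * G (m k) - integral {(real k - 1) * w..real k * w} G"
        using cont w len by (subst integral_diff) (auto intro: integrable_continuous_real)
      moreover have "norm (integral {(real k - 1) * w..real k * w} (\<lambda>x. G (m k) - G x))
          \<le> e / (2 * b) * (real k * w - (real k - 1) * w)"
      proof (rule integral_bound)
        show "(real k - 1) * w \<le> real k * w" using len w by linarith
        show "continuous_on {(real k - 1) * w..real k * w} (\<lambda>x. G (m k) - G x)"
          by (intro continuous_intros cont)
        fix x assume x: "x \<in> {(real k - 1) * w..real k * w}"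
        have "\<bar>m k - x\<bar> \<le> w" using x mk len by (auto simp: abs_le_iff)
        then have "\<bar>G (m k) - G x\<bar> < e / (2 * b)"
          using x mk sub wd by (intro G_d) auto
        then show "norm (G (m k) - G x) \<le> e / (2 * b)" by simp
      qed
      ultimately show ?thesis unfolding len by simp
    qed
    have "integral {0..b} G = (\<Sum>k=1..K. integral {(real k - 1) * w..real k * w} G)"
      using integral_equal_pieces[of K w G K] G w Kw by simp
    then have "norm (w * (\<Sum>k=1..K. G (m k)) - integral {0..b} G) =
      \<bar>\<Sum>k=1..K. w * G (m k) - integral {(real k - 1) * w..real k * w} G\<bar>"
      by (simp add: sum_subtractf sum_distrib_left)
    also have "\<dots> \<le> (\<Sum>k=1..K. e / (2 * b) * w)"
      using piece by (intro order_trans[OF sum_abs] sum_mono) auto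
    also have "\<dots> = e / (2 * b) * (real K * w)" by simp
    also have "\<dots> < e" using e b by (simp add: Kw)
    finally show "norm (b / real K * (\<Sum>k=1..K. G ((2 * real k - 1) / (2 * real K) * b)) - integral {0..b} G) < e"
      by (simp add: w_def m_def)
  qed
qed

text \<open>The weight sqrt(1 - x^2) is sin \<theta>, which up to the factor -R is the derivative of
  r = R cos \<theta> + R. The nodes are the images of the midpoints of K equal pieces of [0, pi], so
  the quadrature is exactly a midpoint sum, and continuity of g is enough for convergence.\<close>

lemma gauss_chebyshev_tendsto:
  fixes g :: "real \<Rightarrow> real"
  assumes g: "continuous_on {0..2 * R} g" and R: "0 < R"
  shows "(\<lambda>K. R * pi / real K * (\<Sum>k=1..K. sqrt (1 - (cheb_node K k)\<^sup>2) * g (R * cheb_node K k + R)))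
    \<longlonglongrightarrow> integral {0..2 * R} g"
proof -
  have range: "R * cos \<theta> + R \<in> {0..2 * R}" for \<theta>
  proof -
    have "0 \<le> R * (1 + cos \<theta>)" "R * (1 + cos \<theta>) \<le> R * 2"
      using R cos_ge_minus_one[of \<theta>] cos_le_one[of \<theta>]
      by (intro mult_nonneg_nonneg mult_left_mono; linarith)+
    then show ?thesis by (simp add: algebra_simps)
  qed
  define G where "G \<theta> = sin \<theta> * g (R * cos \<theta> + R)" for \<theta>
  have "continuous_on {0..pi} G"
    unfolding G_def using range
    by (intro continuous_intros continuous_on_compose2[OF g]) auto
  then have "(\<lambda>K. pi / real K * (\<Sum>k=1..K. G ((2 * real k - 1) / (2 * real K) * pi))) \<longlonglongrightarrow> integral {0..pi} G"
    by (rule midpoint_sums_tendsto_integral) simp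
  then have "(\<lambda>K. R * (pi / real K * (\<Sum>k=1..K. G ((2 * real k - 1) / (2 * real K) * pi)))) \<longlonglongrightarrow> R * integral {0..pi} G"
    by (rule tendsto_mult_left)
  also have "R * integral {0..pi} G = integral {0..2 * R} g"
  proof -
    \<comment> \<open>cos decreases on [0, pi], so the first of the two integrals is over an empty
      interval and only the second remains, with a minus sign.\<close>
    have "((\<lambda>\<theta>. (- R * sin \<theta>) *\<^sub>R g (R * cos \<theta> + R)) has_integral
      (integral {R * cos 0 + R..R * cos pi + R} g - integral {R * cos pi + R..R * cos 0 + R} g)) {0..pi}"
      using range
      by (intro has_integral_substitution_general[where s = "{}", OF _ _ _ g])
         (auto intro!: derivative_eq_intros continuous_intros)
    then have "((\<lambda>\<theta>. - R * G \<theta>) has_integral - integral {0..2 * R} g) {0..pi}"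
      using R by (simp add: G_def ac_simps)
    then have "integral {0..pi} (\<lambda>\<theta>. - R * G \<theta>) = - integral {0..2 * R} g"
      by (rule integral_unique)
    then show ?thesis by simp
  qed
  finally show ?thesis
  proof (rule Lim_transform_eventually)
    show "\<forall>\<^sub>F K in sequentially. R * (pi / real K * (\<Sum>k=1..K. G ((2 * real k - 1) / (2 * real K) * pi))) =
      R * pi / real K * (\<Sum>k=1..K. sqrt (1 - (cheb_node K k)\<^sup>2) * g (R * cheb_node K k + R))"
    proof (rule always_eventually, rule allI)
      fix K
      have "sqrt (1 - (cheb_node K k)\<^sup>2) = sin ((2 * real k - 1) / (2 * real K) * pi)" if "k \<in> {1..K}" for k
      proof -
        let ?t = "(2 * real k - 1) / (2 * real K) * pi"
        \<comment> \<open>The angles lie in [0, pi], where sin is nonnegative, so the root of its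
          square is sin itself.\<close>
        have "(2 * real k - 1) / (2 * real K) \<le> 1" "0 \<le> (2 * real k - 1) / (2 * real K)"
          using that by (auto simp: field_simps)
        then have "0 \<le> ?t" "?t \<le> 1 * pi" by (intro mult_nonneg_nonneg mult_right_mono; simp)+
        then have "0 \<le> sin ?t" by (intro sin_ge_zero) (simp_all only: mult_1)
        moreover have "1 - (cos ?t)\<^sup>2 = (sin ?t)\<^sup>2" by (simp add: sin_squared_eq)
        ultimately show ?thesis by (simp add: cheb_node_def)
      qed
      then have "(\<Sum>k=1..K. sqrt (1 - (cheb_node K k)\<^sup>2) * g (R * cheb_node K k + R)) =
        (\<Sum>k=1..K. G ((2 * real k - 1) / (2 * real K) * pi))"
        by (intro sum.cong) (auto simp: G_def cheb_node_def)
      then show "R * (pi / real K * (\<Sum>k=1..K. G ((2 * real k - 1) / (2 * real K) * pi))) =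
        R * pi / real K * (\<Sum>k=1..K. sqrt (1 - (cheb_node K k)\<^sup>2) * g (R * cheb_node K k + R))"
        by simp
    qed
  qed
qed

text \<open>Away from 0 both factors are continuous. At 0 nothing is known about q except its bound,
  and f squeezes the product to 0. This serves a factor q that jumps at 0.\<close>

lemma continuous_on_mult_vanishing_at_0:
  fixes f q :: "real \<Rightarrow> real"
  assumes f: "continuous_on {0..b} f" "f 0 = 0"
    and q: "\<And>x. 0 < x \<Longrightarrow> isCont q x" "\<And>x. \<bar>q x\<bar> \<le> 1"
  shows "continuous_on {0..b} (\<lambda>x. q x * f x)"
  unfolding continuous_on_def
proof
  fix x assume x: "x \<in> {0..b}"
  have fx: "(f \<longlongrightarrow> f x) (at x within {0..b})"
    using f x by (auto simp: continuous_on_def)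
  show "((\<lambda>x. q x * f x) \<longlongrightarrow> q x * f x) (at x within {0..b})"
  proof (cases "x = 0")
    case True
    have "((\<lambda>x. q x * f x) \<longlongrightarrow> 0) (at x within {0..b})"
    proof (rule Lim_null_comparison)
      show "\<forall>\<^sub>F y in at x within {0..b}. norm (q y * f y) \<le> \<bar>f y\<bar>"
        using q(2) by (intro always_eventually) (auto simp: abs_mult intro!: mult_left_le_one_le)
      show "((\<lambda>y. \<bar>f y\<bar>) \<longlongrightarrow> 0) (at x within {0..b})"
        using tendsto_rabs[OF fx] True f(2) by simp
    qed
    then show ?thesis using True f(2) by simp
  next
    case False
    then have "0 < x" using x by simp
    then have "(q \<longlongrightarrow> q x) (at x within {0..b})"
      using q(1) by (meson isCont_def tendsto_within_subset subset_UNIV)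
    then show ?thesis using fx by (rule tendsto_mult)
  qed
qed

section \<open>Independence and exponential gains\<close>

lemma exp_neg_ennreal: "0 \<le> x \<Longrightarrow> exp_neg (ennreal x) = exp (- x)"
  by (simp add: exp_neg_def)

lemma exp_neg_nonneg: "0 \<le> exp_neg x" and exp_neg_le_1: "exp_neg x \<le> 1"
  by (simp_all add: exp_neg_def)

lemma exp_neg_add: "exp_neg (x + y) = exp_neg x * exp_neg y"
  by (auto simp: exp_neg_def enn2real_plus exp_add[symmetric] less_top)

lemma borel_measurable_exp_neg [measurable]: "exp_neg \<in> borel_measurable borel"
  unfolding exp_neg_def[abs_def] by measurable

text \<open>Continuity at infinity is the extra point: a value of f above |ln e| makes its
  \<open>exp_neg\<close> less than e, and the absolute value keeps the bound nonnegative under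
  \<open>ennreal\<close>. At a finite limit the values are eventually finite and
  \<open>enn2real\<close> is continuous.\<close>

lemma tendsto_exp_neg:
  assumes "(f \<longlongrightarrow> x) F"
  shows "((\<lambda>a. exp_neg (f a)) \<longlongrightarrow> exp_neg x) F"
proof (cases "x = \<top>")
  case True
  have "\<forall>\<^sub>F a in F. exp_neg (f a) < e" if "0 < e" for e
  proof -
    have "\<forall>\<^sub>F a in F. ennreal \<bar>ln e\<bar> < f a"
      using assms unfolding True by (intro order_tendstoD(1)) auto
    then show ?thesis
    proof eventually_elim
      case (elim a)
      show ?case
      proof (cases "f a")
        case (real r)
        with elim have "- ln e < r" by (simp add: ennreal_less_iff)
        then have "exp (- r) < exp (ln e)" by simp
        with real that show ?thesis by (simp add: exp_neg_ennreal)
      qed (use that in \<open>simp add: exp_neg_def\<close>)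
    qed
  qed
  then have "((\<lambda>a. exp_neg (f a)) \<longlongrightarrow> 0) F"
    by (intro order_tendstoI) (auto intro!: always_eventually intro: less_le_trans exp_neg_nonneg)
  then show ?thesis using True by (simp add: exp_neg_def)
next
  case False
  have "\<forall>\<^sub>F a in F. f a < \<top>"
    using False assms by (intro order_tendstoD(2)) (auto simp: less_top)
  moreover have "((\<lambda>a. enn2real (f a)) \<longlongrightarrow> enn2real x) F"
    using tendsto_enn2real[of f "enn2real x" F] assms False by (simp add: less_top)
  then have "((\<lambda>a. exp (- enn2real (f a))) \<longlongrightarrow> exp_neg x) F"
    using False by (auto simp: exp_neg_def intro!: tendsto_intros)
  ultimately show ?thesis
    by (elim Lim_transform_eventually) (auto elim!: eventually_mono simp: exp_neg_def)
qed

text \<open>Finite partial products are \<open>exp_neg\<close> of finite partial sums, and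
  \<open>exp_neg\<close> is continuous up to infinity. This links the product in the interference
  identity with the sum in the SINR, including a divergent sum, whose product diverges to 0.\<close>

lemma infprod_exp_neg:
  assumes "\<And>j. j \<in> A \<Longrightarrow> 0 \<le> x j"
  shows "infprod (\<lambda>j. exp (- x j)) A = exp_neg (\<Sum>\<^sub>\<infinity>j\<in>A. ennreal (x j))"
proof -
  have "((\<lambda>j. ennreal (x j)) has_sum (\<Sum>\<^sub>\<infinity>j\<in>A. ennreal (x j))) A"
    by (intro has_sum_infsum nonneg_summable_on_complete) simp
  then have "((\<lambda>F. exp_neg (\<Sum>j\<in>F. ennreal (x j))) \<longlongrightarrow> exp_neg (\<Sum>\<^sub>\<infinity>j\<in>A. ennreal (x j))) (finite_subsets_at_top A)"
    unfolding has_sum_def by (rule tendsto_exp_neg)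
  moreover have "\<forall>\<^sub>F F in finite_subsets_at_top A. exp_neg (\<Sum>j\<in>F. ennreal (x j)) = (\<Prod>j\<in>F. exp (- x j))"
  proof (rule eventually_finite_subsets_at_top_weakI)
    fix F assume F: "finite F" "F \<subseteq> A"
    then have "(\<Sum>j\<in>F. ennreal (x j)) = ennreal (\<Sum>j\<in>F. x j)" "0 \<le> (\<Sum>j\<in>F. x j)"
      using assms by (auto intro!: sum_ennreal sum_nonneg)
    then show "exp_neg (\<Sum>j\<in>F. ennreal (x j)) = (\<Prod>j\<in>F. exp (- x j))"
      using F by (simp add: exp_neg_ennreal exp_sum sum_negf[symmetric])
  qed
  ultimately have "((\<lambda>F. \<Prod>j\<in>F. exp (- x j)) \<longlongrightarrow> exp_neg (\<Sum>\<^sub>\<infinity>j\<in>A. ennreal (x j))) (finite_subsets_at_top A)"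
    by (rule Lim_transform_eventually)
  then show ?thesis
    unfolding infprod_def by (intro tendsto_Lim) auto
qed

text \<open>The set of active transmitters is random. Written as a series over all labels, the sum
  is measurable as soon as each term, switched on and off by an event, is.\<close>

lemma infsum_ennreal_eq_suminf:
  fixes f :: "nat \<Rightarrow> ennreal"
  shows "(\<Sum>\<^sub>\<infinity>j\<in>A. f j) = (\<Sum>j. if j \<in> A then f j else 0)"
proof -
  have "(\<Sum>\<^sub>\<infinity>j\<in>A. f j) = (\<Sum>\<^sub>\<infinity>j. if j \<in> A then f j else 0)"
    by (intro infsum_cong_neutral) auto
  moreover have "((\<lambda>j. if j \<in> A then f j else 0) has_sum (\<Sum>\<^sub>\<infinity>j. if j \<in> A then f j else 0)) UNIV"
    by (intro has_sum_infsum nonneg_summable_on_complete) simp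
  ultimately show ?thesis
    using has_sum_imp_sums sums_unique by metis
qed

section \<open>Integrals over independent variables\<close>

context prob_space begin

lemma indep_set_mono: "indep_set A B \<Longrightarrow> A' \<subseteq> A \<Longrightarrow> B' \<subseteq> B \<Longrightarrow> indep_set A' B'"
  unfolding indep_sets2_eq by blast

text \<open>Independence fixes the joint law on rectangles as the product of the marginals, and
  Tonelli does the rest. This is the freezing principle: in the inner integral g is held at its
  value at \<omega>', which plays the part of conditioning on g.\<close>

lemma indep_rvs_nn_integral:
  assumes indep: "indep_rvs M S f T g" and F[measurable]: "F \<in> borel_measurable (S \<Otimes>\<^sub>M T)"
  shows "(\<integral>\<^sup>+\<omega>. F (f \<omega>, g \<omega>) \<partial>M) = (\<integral>\<^sup>+\<omega>'. \<integral>\<^sup>+\<omega>. F (f \<omega>, g \<omega>') \<partial>M \<partial>M)"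
proof -
  have f[measurable]: "f \<in> measurable M S" and g[measurable]: "g \<in> measurable M T"
    and ind: "indep_set {f -` A \<inter> space M |A. A \<in> sets S} {g -` B \<inter> space M |B. B \<in> sets T}"
    using indep by (auto simp: indep_rvs_def)
  interpret f: prob_space "distr M S f" by (rule prob_space_distr) fact
  interpret g: prob_space "distr M T g" by (rule prob_space_distr) fact
  interpret fg: pair_prob_space "distr M S f" "distr M T g" ..
  have "distr M S f \<Otimes>\<^sub>M distr M T g = distr M (S \<Otimes>\<^sub>M T) (\<lambda>\<omega>. (f \<omega>, g \<omega>))"
  proof (rule pair_measure_eqI)
    fix A B assume "A \<in> sets (distr M S f)" "B \<in> sets (distr M T g)"
    then have [measurable]: "A \<in> sets S" "B \<in> sets T" by auto
    have "emeasure (distr M (S \<Otimes>\<^sub>M T) (\<lambda>\<omega>. (f \<omega>, g \<omega>))) (A \<times> B) =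
        emeasure M ((f -` A \<inter> space M) \<inter> (g -` B \<inter> space M))"
      by (subst emeasure_distr) (auto intro!: arg_cong[where f = "emeasure M"])
    also have "\<dots> = emeasure M (f -` A \<inter> space M) * emeasure M (g -` B \<inter> space M)"
      unfolding emeasure_eq_measure
      by (subst indep_setD[OF ind]) (auto simp: ennreal_mult)
    finally show "emeasure (distr M S f) A * emeasure (distr M T g) B =
        emeasure (distr M (S \<Otimes>\<^sub>M T) (\<lambda>\<omega>. (f \<omega>, g \<omega>))) (A \<times> B)"
      by (simp add: emeasure_distr)
  qed (simp_all add: f.sigma_finite_measure_axioms g.sigma_finite_measure_axioms)
  then have "(\<integral>\<^sup>+\<omega>. F (f \<omega>, g \<omega>) \<partial>M) = (\<integral>\<^sup>+p. F p \<partial>(distr M S f \<Otimes>\<^sub>M distr M T g))"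
    by (simp add: nn_integral_distr)
  also have "\<dots> = (\<integral>\<^sup>+y. \<integral>\<^sup>+x. F (x, y) \<partial>distr M S f \<partial>distr M T g)"
    using fg.nn_integral_snd[of F] by (simp add: case_prod_unfold)
  also have "\<dots> = (\<integral>\<^sup>+\<omega>'. \<integral>\<^sup>+x. F (x, g \<omega>') \<partial>distr M S f \<partial>M)"
    by (subst nn_integral_distr) (auto intro!: f.borel_measurable_nn_integral simp: case_prod_unfold)
  also have "\<dots> = (\<integral>\<^sup>+\<omega>'. \<integral>\<^sup>+\<omega>. F (f \<omega>, g \<omega>') \<partial>M \<partial>M)"
    by (intro nn_integral_cong, subst nn_integral_distr) (auto dest: measurable_space[OF g])
  finally show ?thesis .
qed

lemma indep_rvs_nn_integral_mult:
  assumes indep: "indep_rvs M S f T g"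
    and [measurable]: "u \<in> borel_measurable S" "v \<in> borel_measurable T"
  shows "(\<integral>\<^sup>+\<omega>. u (f \<omega>) * v (g \<omega>) \<partial>M) = (\<integral>\<^sup>+\<omega>. u (f \<omega>) \<partial>M) * (\<integral>\<^sup>+\<omega>. v (g \<omega>) \<partial>M)"
proof -
  have [measurable]: "f \<in> measurable M S" "g \<in> measurable M T"
    using indep by (auto simp: indep_rvs_def)
  show ?thesis
    using indep_rvs_nn_integral[OF indep, of "\<lambda>(x, y). u x * v y"]
    by (simp add: nn_integral_multc nn_integral_cmult)
qed

lemma indep_rvs_compose:
  assumes indep: "indep_rvs M S f T g"
    and \<phi>: "\<phi> \<in> measurable S S'" and \<psi>: "\<psi> \<in> measurable T T'"
  shows "indep_rvs M S' (\<lambda>\<omega>. \<phi> (f \<omega>)) T' (\<lambda>\<omega>. \<psi> (g \<omega>))"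
proof -
  have f: "f \<in> measurable M S" and g: "g \<in> measurable M T"
    and ind: "indep_set {f -` A \<inter> space M |A. A \<in> sets S} {g -` B \<inter> space M |B. B \<in> sets T}"
    using indep by (auto simp: indep_rvs_def)
  have "\<exists>A'. (\<lambda>\<omega>. \<phi> (f \<omega>)) -` A \<inter> space M = f -` A' \<inter> space M \<and> A' \<in> sets S" if "A \<in> sets S'" for A
    using measurable_sets[OF \<phi> that] measurable_space[OF f]
    by (intro exI[of _ "\<phi> -` A \<inter> space S"]) auto
  then have 1: "{(\<lambda>\<omega>. \<phi> (f \<omega>)) -` A \<inter> space M |A. A \<in> sets S'} \<subseteq> {f -` A \<inter> space M |A. A \<in> sets S}"
    by auto
  have "\<exists>A'. (\<lambda>\<omega>. \<psi> (g \<omega>)) -` A \<inter> space M = g -` A' \<inter> space M \<and> A' \<in> sets T" if "A \<in> sets T'" for A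
    using measurable_sets[OF \<psi> that] measurable_space[OF g]
    by (intro exI[of _ "\<psi> -` A \<inter> space T"]) auto
  then have 2: "{(\<lambda>\<omega>. \<psi> (g \<omega>)) -` B \<inter> space M |B. B \<in> sets T'} \<subseteq> {g -` B \<inter> space M |B. B \<in> sets T}"
    by auto
  show ?thesis
    unfolding indep_rvs_def
    by (intro conjI measurable_compose[OF f \<phi>] measurable_compose[OF g \<psi>] indep_set_mono[OF ind 1 2])
qed

lemma indep_var_imp_indep_rvs: "indep_var S f T g \<Longrightarrow> indep_rvs M S f T g"
  unfolding indep_var_eq indep_rvs_def
  by (auto intro!: sigma_sets.Basic elim!: indep_set_mono)

lemma indep_rvs_singleton_rest:
  assumes indep: "indep_vars (\<lambda>_. N) H UNIV"
  shows "indep_rvs M N (H i) (\<Pi>\<^sub>M _\<in>- {i}. N) (\<lambda>\<omega>. \<lambda>j\<in>- {i}. H j \<omega>)"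
proof -
  have "indep_rvs M (\<Pi>\<^sub>M _\<in>{i}. N) (\<lambda>\<omega>. \<lambda>j\<in>{i}. H j \<omega>) (\<Pi>\<^sub>M _\<in>- {i}. N) (\<lambda>\<omega>. \<lambda>j\<in>- {i}. H j \<omega>)"
    by (intro indep_var_imp_indep_rvs indep_var_restrict[OF indep]) auto
  from indep_rvs_compose[OF this, of "\<lambda>x. x i" N "\<lambda>x. x"] show ?thesis
    by simp
qed

text \<open>For D = top the event is empty and both sides are 0. For finite D = a the event is x
  \<ge> a; when a = 0 it also contains the negative x, which \<open>ennreal\<close> sends to 0, but
  these carry no density.\<close>

lemma exponential_tail:
  assumes X: "distributed M lborel X (exponential_density 1)"
  shows "(\<integral>\<^sup>+\<omega>. indicator {x. D \<le> ennreal x} (X \<omega>) \<partial>M) = ennreal (exp_neg D)"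
proof (cases D)
  case (real a)
  have "(\<integral>\<^sup>+\<omega>. indicator {x. D \<le> ennreal x} (X \<omega>) \<partial>M) =
      (\<integral>\<^sup>+x. ennreal (exponential_density 1 x) * indicator {x. D \<le> ennreal x} x \<partial>lborel)"
    by (subst distributed_nn_integral[OF X]) auto
  also have "\<dots> = (\<integral>\<^sup>+x. ennreal (exp (- x)) * indicator {a..} x \<partial>lborel)"
  proof (intro nn_integral_cong)
    fix x :: real
    show "ennreal (exponential_density 1 x) * indicator {x. D \<le> ennreal x} x = ennreal (exp (- x)) * indicator {a..} x"
      using real by (cases "0 \<le> x") (auto simp: exponential_density_def split: split_indicator)
  qed
  also have "\<dots> = ennreal (0 - (- exp (- a)))"
  proof (rule nn_integral_FTC_atLeast)
    show "((\<lambda>x::real. - exp (- x)) \<longlongrightarrow> 0) at_top"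
      using tendsto_minus[OF filterlim_compose[OF exp_at_bot filterlim_uminus_at_bot_at_top]] by simp
  qed (auto intro!: derivative_eq_intros)
  finally show ?thesis using real by (simp add: exp_neg_ennreal)
qed (simp add: exp_neg_def top_unique)

lemma exponential_Laplace:
  assumes X: "distributed M lborel X (exponential_density 1)" and s: "0 \<le> s"
  shows "(\<integral>\<^sup>+\<omega>. ennreal (exp (- (s * X \<omega>))) \<partial>M) = ennreal (1 / (1 + s))"
proof -
  have "(\<integral>\<^sup>+\<omega>. ennreal (exp (- (s * X \<omega>))) \<partial>M) =
      (\<integral>\<^sup>+x. ennreal (exponential_density 1 x) * ennreal (exp (- (s * x))) \<partial>lborel)"
    by (subst distributed_nn_integral[OF X]) auto
  also have "\<dots> = (\<integral>\<^sup>+x. ennreal (exp (- ((1 + s) * x))) * indicator {0..} x \<partial>lborel)"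
    by (intro nn_integral_cong)
       (auto simp: exponential_density_def ennreal_mult[symmetric] exp_add[symmetric] algebra_simps split: split_indicator)
  also have "\<dots> = ennreal (0 - (- exp (- ((1 + s) * 0)) / (1 + s)))"
  proof (rule nn_integral_FTC_atLeast)
    have "filterlim (\<lambda>x. (1 + s) * x) at_top at_top"
      using s by (intro filterlim_tendsto_pos_mult_at_top[OF tendsto_const] filterlim_ident) auto
    then have "((\<lambda>x. exp (- ((1 + s) * x))) \<longlongrightarrow> 0) at_top"
      by (intro filterlim_compose[OF exp_at_bot] filterlim_compose[OF filterlim_uminus_at_bot_at_top])
    from tendsto_minus[OF tendsto_divide[OF this tendsto_const, of "1 + s"]]
    show "((\<lambda>x. - exp (- ((1 + s) * x)) / (1 + s)) \<longlongrightarrow> 0) at_top"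
      using s by simp
    show "DERIV (\<lambda>x. - exp (- ((1 + s) * x)) / (1 + s)) x :> exp (- ((1 + s) * x))" for x
    proof -
      have "DERIV (\<lambda>x. - exp (- ((1 + s) * x))) x :> exp (- ((1 + s) * x)) * (1 + s)"
        by (auto intro!: derivative_eq_intros simp: algebra_simps)
      from DERIV_cdivide[OF this, of "1 + s"] show ?thesis using s by simp
    qed
  qed auto
  finally show ?thesis by simp
qed

text \<open>Here i is the desired link, c the cellular one, and the other gains form
  \<open>Hr\<close>; W and Z hold the positions of user and receiver and the data of the
  interferers. With W and Z frozen, the tail of \<open>H i\<close> turns the threshold into
  \<open>exp_neg\<close> of a sum, hence a product; \<open>H c\<close> is independent of
  \<open>Hr\<close> and contributes its Laplace transform. Averaging over W and Z then splits by
  their independence.\<close>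

lemma nn_integral_exponential_threshold:
  fixes H :: "'k \<Rightarrow> 'a \<Rightarrow> real"
  assumes "i \<noteq> c"
    and vars: "indep_vars (\<lambda>_. borel) H UNIV"
    and HV: "indep_rvs M (\<Pi>\<^sub>M _\<in>UNIV. borel) (\<lambda>\<omega> k. H k \<omega>) (SW \<Otimes>\<^sub>M SZ) (\<lambda>\<omega>. (W \<omega>, Z \<omega>))"
    and WZ: "indep_rvs M SW W SZ Z"
    and Hi: "distributed M lborel (H i) (exponential_density 1)"
    and Hc: "distributed M lborel (H c) (exponential_density 1)" "\<And>\<omega>. 0 \<le> H c \<omega>"
    and J[measurable]: "J \<in> borel_measurable ((\<Pi>\<^sub>M _\<in>- {i, c}. borel) \<Otimes>\<^sub>M SZ)"
    and s[measurable]: "s \<in> borel_measurable SW" and s_nonneg: "\<And>w. 0 \<le> s w" and n: "0 \<le> n"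
  shows "(\<integral>\<^sup>+\<omega>. indicator {x. J (\<lambda>k\<in>- {i, c}. H k \<omega>, Z \<omega>) + ennreal (s (W \<omega>) * H c \<omega>) + ennreal n \<le> ennreal x} (H i \<omega>) \<partial>M) =
    ennreal (exp (- n)) * (\<integral>\<^sup>+\<omega>. ennreal (exp_neg (J (\<lambda>k\<in>- {i, c}. H k \<omega>, Z \<omega>))) \<partial>M) *
      (\<integral>\<^sup>+\<omega>. ennreal (1 / (1 + s (W \<omega>))) \<partial>M)"
proof -
  let ?P = "\<Pi>\<^sub>M _\<in>- {i, c}. borel :: real measure"
  define Hr where "Hr \<omega> = (\<lambda>k\<in>- {i, c}. H k \<omega>)" for \<omega>
  have H[measurable]: "H k \<in> borel_measurable M" for k
    using vars by (auto simp: indep_vars_def)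
  have [measurable]: "Hr \<in> measurable M ?P"
    unfolding Hr_def by (intro measurable_restrict) measurable
  have [measurable]: "W \<in> measurable M SW" "Z \<in> measurable M SZ"
    using WZ by (auto simp: indep_rvs_def)
  have restrict_to_Hr: "(\<lambda>x. \<lambda>k\<in>- {i, c}. x k) \<in> measurable (\<Pi>\<^sub>M _\<in>K. borel :: real measure) ?P"
    if "- {i, c} \<subseteq> K" for K
    using that by (intro measurable_restrict measurable_component_singleton) auto
  have i_rest: "indep_rvs M borel (H i) (?P \<Otimes>\<^sub>M borel) (\<lambda>\<omega>. (Hr \<omega>, H c \<omega>))"
  proof -
    have "(\<lambda>x. (\<lambda>k\<in>- {i, c}. x k, x c)) \<in> measurable (\<Pi>\<^sub>M _\<in>- {i}. borel :: real measure) (?P \<Otimes>\<^sub>M borel)"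
      using \<open>i \<noteq> c\<close> by (intro measurable_Pair restrict_to_Hr measurable_component_singleton) auto
    from indep_rvs_compose[OF indep_rvs_singleton_rest[OF vars, of i] measurable_ident this]
    show ?thesis using \<open>i \<noteq> c\<close> by (simp add: Hr_def restrict_def cong: if_cong)
  qed
  have c_rest: "indep_rvs M borel (H c) ?P Hr"
  proof -
    have "(\<lambda>x. \<lambda>k\<in>- {i, c}. x k) \<in> measurable (\<Pi>\<^sub>M _\<in>- {c}. borel :: real measure) ?P"
      by (rule restrict_to_Hr) auto
    from indep_rvs_compose[OF indep_rvs_singleton_rest[OF vars, of c] measurable_ident this]
    show ?thesis by (simp add: Hr_def[abs_def] restrict_def cong: if_cong)
  qed
  have Hr_Z: "indep_rvs M ?P Hr SZ Z"
    using indep_rvs_compose[OF HV restrict_to_Hr measurable_snd] by (simp add: Hr_def[abs_def])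
  \<comment> \<open>Only the gains are random here: w and z are constants. Membership of z in the
    space of \<open>SZ\<close> makes the section of J at z measurable.\<close>
  have fixed: "(\<integral>\<^sup>+\<omega>. indicator {x. J (Hr \<omega>, z) + ennreal (s w * H c \<omega>) + ennreal n \<le> ennreal x} (H i \<omega>) \<partial>M) =
      ennreal (exp (- n)) * ((\<integral>\<^sup>+\<omega>. ennreal (exp_neg (J (Hr \<omega>, z))) \<partial>M) * ennreal (1 / (1 + s w)))"
    if z[measurable]: "z \<in> space SZ" for w z
  proof -
    have "(\<integral>\<^sup>+\<omega>. indicator {x. J (Hr \<omega>, z) + ennreal (s w * H c \<omega>) + ennreal n \<le> ennreal x} (H i \<omega>) \<partial>M) =
      (\<integral>\<^sup>+\<omega>'. \<integral>\<^sup>+\<omega>. indicator {x. J (Hr \<omega>', z) + ennreal (s w * H c \<omega>') + ennreal n \<le> ennreal x} (H i \<omega>) \<partial>M \<partial>M)"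
      using indep_rvs_nn_integral[OF i_rest,
          of "\<lambda>(x, r, y). indicator {x. J (r, z) + ennreal (s w * y) + ennreal n \<le> ennreal x} x"]
      by simp
    also have "\<dots> = (\<integral>\<^sup>+\<omega>. ennreal (exp_neg (J (Hr \<omega>, z) + ennreal (s w * H c \<omega>) + ennreal n)) \<partial>M)"
      by (subst exponential_tail[OF Hi]) simp
    also have "\<dots> = (\<integral>\<^sup>+\<omega>. ennreal (exp (- n)) * (ennreal (exp (- (s w * H c \<omega>))) * ennreal (exp_neg (J (Hr \<omega>, z)))) \<partial>M)"
    proof (intro nn_integral_cong)
      fix \<omega>
      have "exp_neg (J (Hr \<omega>, z) + ennreal (s w * H c \<omega>) + ennreal n) =
          exp (- n) * (exp (- (s w * H c \<omega>)) * exp_neg (J (Hr \<omega>, z)))"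
        unfolding exp_neg_add
        by (subst (1 2) exp_neg_ennreal) (simp_all add: n Hc(2) s_nonneg)
      then show "ennreal (exp_neg (J (Hr \<omega>, z) + ennreal (s w * H c \<omega>) + ennreal n)) =
          ennreal (exp (- n)) * (ennreal (exp (- (s w * H c \<omega>))) * ennreal (exp_neg (J (Hr \<omega>, z))))"
        by (simp add: ennreal_mult' exp_neg_nonneg)
    qed
    also have "\<dots> = ennreal (exp (- n)) * (\<integral>\<^sup>+\<omega>. ennreal (exp (- (s w * H c \<omega>))) * ennreal (exp_neg (J (Hr \<omega>, z))) \<partial>M)"
      by (rule nn_integral_cmult) measurable
    also have "(\<integral>\<^sup>+\<omega>. ennreal (exp (- (s w * H c \<omega>))) * ennreal (exp_neg (J (Hr \<omega>, z))) \<partial>M) =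
        (\<integral>\<^sup>+\<omega>. ennreal (exp (- (s w * H c \<omega>))) \<partial>M) * (\<integral>\<^sup>+\<omega>. ennreal (exp_neg (J (Hr \<omega>, z))) \<partial>M)"
      by (rule indep_rvs_nn_integral_mult[OF c_rest]) measurable
    finally show ?thesis
      by (simp add: exponential_Laplace[OF Hc(1) s_nonneg] mult.commute)
  qed
  have "(\<integral>\<^sup>+\<omega>. indicator {x. J (Hr \<omega>, Z \<omega>) + ennreal (s (W \<omega>) * H c \<omega>) + ennreal n \<le> ennreal x} (H i \<omega>) \<partial>M) =
    (\<integral>\<^sup>+\<omega>'. \<integral>\<^sup>+\<omega>. indicator {x. J (Hr \<omega>, Z \<omega>') + ennreal (s (W \<omega>') * H c \<omega>) + ennreal n \<le> ennreal x} (H i \<omega>) \<partial>M \<partial>M)"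
  proof -
    have [measurable]: "(\<lambda>p. \<lambda>k\<in>- {i, c}. fst p k) \<in> measurable ((\<Pi>\<^sub>M _\<in>UNIV. borel :: real measure) \<Otimes>\<^sub>M (SW \<Otimes>\<^sub>M SZ)) ?P"
      by (rule measurable_compose[OF measurable_fst restrict_to_Hr]) auto
    show ?thesis
      using indep_rvs_nn_integral[OF HV,
          of "\<lambda>p. indicator {x. J (\<lambda>k\<in>- {i, c}. fst p k, snd (snd p)) + ennreal (s (fst (snd p)) * fst p c) + ennreal n \<le> ennreal x} (fst p i)"]
      by (simp add: Hr_def)
  qed
  also have "\<dots> = (\<integral>\<^sup>+\<omega>'. ennreal (exp (- n)) *
      (ennreal (1 / (1 + s (W \<omega>'))) * (\<integral>\<^sup>+\<omega>. ennreal (exp_neg (J (Hr \<omega>, Z \<omega>'))) \<partial>M)) \<partial>M)"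
    by (intro nn_integral_cong, subst fixed) (auto simp: mult.commute dest: measurable_space[OF \<open>Z \<in> measurable M SZ\<close>])
  also have "\<dots> = ennreal (exp (- n)) *
      (\<integral>\<^sup>+\<omega>'. ennreal (1 / (1 + s (W \<omega>'))) * (\<integral>\<^sup>+\<omega>. ennreal (exp_neg (J (Hr \<omega>, Z \<omega>'))) \<partial>M) \<partial>M)"
    by (rule nn_integral_cmult) measurable
  also have "(\<integral>\<^sup>+\<omega>'. ennreal (1 / (1 + s (W \<omega>'))) * (\<integral>\<^sup>+\<omega>. ennreal (exp_neg (J (Hr \<omega>, Z \<omega>'))) \<partial>M) \<partial>M) =
      (\<integral>\<^sup>+\<omega>'. ennreal (1 / (1 + s (W \<omega>'))) \<partial>M) * (\<integral>\<^sup>+\<omega>'. \<integral>\<^sup>+\<omega>. ennreal (exp_neg (J (Hr \<omega>, Z \<omega>'))) \<partial>M \<partial>M)"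
    by (rule indep_rvs_nn_integral_mult[OF WZ]) measurable
  \<comment> \<open>The freezing principle is read backwards: \<open>Hr\<close> and Z are put on one
    sample again, so that the joint mean of the interference appears.\<close>
  also have "(\<integral>\<^sup>+\<omega>'. \<integral>\<^sup>+\<omega>. ennreal (exp_neg (J (Hr \<omega>, Z \<omega>'))) \<partial>M \<partial>M) = (\<integral>\<^sup>+\<omega>. ennreal (exp_neg (J (Hr \<omega>, Z \<omega>))) \<partial>M)"
    using indep_rvs_nn_integral[OF Hr_Z, of "\<lambda>p. ennreal (exp_neg (J p))"] by simp
  finally show ?thesis unfolding Hr_def by (simp only: mult_ac)
qed

end

section \<open>The outage probability\<close>

text \<open>With x = r/(2R) the bracket is 2/pi times arccos x - x sqrt(1 - x^2). Here sqrt(1 - x^2)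
  = sin(arccos x) \<le> arccos x, and x \<le> 1.\<close>

lemma disk_distance_density_nonneg:
  assumes R: "0 < R"
  shows "0 \<le> disk_distance_density R r"
proof (cases "0 \<le> r \<and> r \<le> 2 * R")
  case True
  define x where "x = r / (2 * R)"
  have x: "0 \<le> x" "x \<le> 1" using True R by (auto simp: x_def)
  have arc: "0 \<le> arccos x" using x by (intro arccos_lbound) auto
  have sin: "sin (arccos x) = sqrt (1 - x\<^sup>2)" using x by (intro sin_arccos_abs) auto
  have "x * sqrt (1 - x\<^sup>2) \<le> 1 * sqrt (1 - x\<^sup>2)"
    using x by (intro mult_right_mono) (auto simp: abs_square_le_1)
  also have "\<dots> \<le> arccos x" using sin_x_le_x[OF arc] sin by simp
  finally have "0 \<le> 2 / pi * (arccos x - x * sqrt (1 - x\<^sup>2))" by simp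
  also have "\<dots> = 2 / pi * arccos x - r / (pi * R) * sqrt (1 - x\<^sup>2)"
    using R by (simp add: x_def field_simps)
  finally show ?thesis
    using True by (simp add: disk_distance_density_def x_def power_divide power_mult_distrib)
qed (auto simp: disk_distance_density_def)

lemma AE_distributed_lborel_neq:
  assumes X: "distributed M lborel X f"
  shows "AE \<omega> in M. X \<omega> \<noteq> (a :: real)"
proof -
  have "AE x in lborel. x \<noteq> a" by (rule AE_lborel_singleton)
  then have "AE x in distr M lborel X. x \<noteq> a"
    unfolding distributed_distr_eq_density[OF X]
    using X by (subst AE_density) (auto simp: distributed_def)
  with distributed_measurable[OF X] show ?thesis
    by (rule AE_distrD)
qed

text \<open>The change of variables v = r^2 is made on bounded intervals and carried to the
  half-line by monotone convergence, so both sides may be infinite.\<close>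

lemma nn_integral_square_substitution:
  fixes f :: "real \<Rightarrow> ennreal"
  assumes f[measurable]: "f \<in> borel_measurable borel" and p: "0 \<le> p"
  shows "(\<integral>\<^sup>+v. f v * indicator {p\<^sup>2..} v \<partial>lborel) = (\<integral>\<^sup>+r. f (r\<^sup>2) * ennreal (2 * r) * indicator {p..} r \<partial>lborel)"
proof -
  \<comment> \<open>The summand 1 gives b n > p already at n = 0, and b n \<ge> 1, so that (b n)^2
    \<ge> b n also grows beyond every bound.\<close>
  define b where "b n = p + 1 + real n" for n
  have b: "0 \<le> b n" "p < b n" for n using p by (auto simp: b_def)
  have mono: "b m \<le> b n" "(b m)\<^sup>2 \<le> (b n)\<^sup>2" if "m \<le> n" for m n
    using that b(1)[of m] by (auto simp: b_def intro!: power_mono)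
  have large: "\<forall>\<^sub>F n in sequentially. x \<le> b n \<and> x \<le> (b n)\<^sup>2" for x
  proof -
    obtain N where N: "\<bar>x\<bar> < real N" using reals_Archimedean2 by blast
    show ?thesis
    proof (rule eventually_sequentiallyI)
      fix n assume "N \<le> n"
      then have "x \<le> b n" "1 \<le> b n" using N p by (auto simp: b_def)
      then have "x \<le> b n * b n" using mult_left_mono[of 1 "b n" "b n"] by linarith
      then show "x \<le> b n \<and> x \<le> (b n)\<^sup>2" using \<open>x \<le> b n\<close> by (simp add: power2_eq_square)
    qed
  qed
  have left: "(\<lambda>n. \<integral>\<^sup>+v. f v * indicator {p\<^sup>2..(b n)\<^sup>2} v \<partial>lborel) \<longlonglongrightarrow> (\<integral>\<^sup>+v. f v * indicator {p\<^sup>2..} v \<partial>lborel)"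
  proof (rule nn_integral_LIMSEQ)
    show "incseq (\<lambda>n v. f v * indicator {p\<^sup>2..(b n)\<^sup>2} v)"
      using mono(2) by (auto simp: incseq_def le_fun_def split: split_indicator intro: order_trans)
    show "(\<lambda>n. f v * indicator {p\<^sup>2..(b n)\<^sup>2} v) \<longlonglongrightarrow> f v * indicator {p\<^sup>2..} v" for v
      using large[of v] by (intro tendsto_eventually, elim eventually_mono) (auto simp: indicator_def)
  qed measurable
  have "(\<lambda>n. \<integral>\<^sup>+r. f (r\<^sup>2) * ennreal (2 * r) * indicator {p..b n} r \<partial>lborel) \<longlonglongrightarrow>
      (\<integral>\<^sup>+r. f (r\<^sup>2) * ennreal (2 * r) * indicator {p..} r \<partial>lborel)"
  proof (rule nn_integral_LIMSEQ)
    show "incseq (\<lambda>n r. f (r\<^sup>2) * ennreal (2 * r) * indicator {p..b n} r)"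
      using mono(1) by (auto simp: incseq_def le_fun_def split: split_indicator intro: order_trans)
    show "(\<lambda>n. f (r\<^sup>2) * ennreal (2 * r) * indicator {p..b n} r) \<longlonglongrightarrow> f (r\<^sup>2) * ennreal (2 * r) * indicator {p..} r" for r
      using large[of r] by (intro tendsto_eventually, elim eventually_mono) (auto simp: indicator_def)
  qed measurable
  moreover have "(\<integral>\<^sup>+v. f v * indicator {p\<^sup>2..(b n)\<^sup>2} v \<partial>lborel) =
      (\<integral>\<^sup>+r. f (r\<^sup>2) * ennreal (2 * r) * indicator {p..b n} r \<partial>lborel)" for n
    using b p by (intro nn_integral_substitution_aux[where g = "\<lambda>r. r\<^sup>2"])
      (auto intro!: derivative_eq_intros continuous_intros)
  ultimately show ?thesis
    using LIMSEQ_unique[OF left] by simp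
qed

text \<open>With t = \<gamma> r^(-\<alpha>) / d^(-\<alpha>) one has 1 - L r = 1 - 1/(1 + t) = 1/(1 +
  1/t), and 1/t is d^(-\<alpha>) v^(\<alpha>/2) / \<gamma> for v = r^2. The factor 2 of the left
  constant is used up by 2 r dr = dv. Positivity of p keeps r > 0, where the power laws
  hold.\<close>

lemma interference_exponent_square_substitution:
  fixes \<alpha> \<gamma> d p lam :: real
  assumes "0 < \<alpha>" and \<gamma>: "0 < \<gamma>" and d: "0 < d" and p: "0 < p"
    and L: "\<And>r. L r = 1 / (1 + \<gamma> * r powr (-\<alpha>) / d powr (-\<alpha>))"
  shows "ennreal (2 * pi * lam) * (\<integral>\<^sup>+r\<in>{p..}. ennreal ((1 - L r) * r) \<partial>lborel) =
    ennreal (pi * lam) * (\<integral>\<^sup>+v\<in>{p\<^sup>2..}. ennreal (1 / (1 + d powr (-\<alpha>) * v powr (\<alpha> / 2) / \<gamma>)) \<partial>lborel)"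
proof -
  let ?f = "\<lambda>v. ennreal (1 / (1 + d powr (-\<alpha>) * v powr (\<alpha> / 2) / \<gamma>))"
  have "(\<integral>\<^sup>+v\<in>{p\<^sup>2..}. ?f v \<partial>lborel) = (\<integral>\<^sup>+r. ?f (r\<^sup>2) * ennreal (2 * r) * indicator {p..} r \<partial>lborel)"
    using p by (intro nn_integral_square_substitution) auto
  also have "\<dots> = (\<integral>\<^sup>+r. 2 * (ennreal ((1 - L r) * r) * indicator {p..} r) \<partial>lborel)"
  proof (intro nn_integral_cong)
    fix r :: real
    show "?f (r\<^sup>2) * ennreal (2 * r) * indicator {p..} r = 2 * (ennreal ((1 - L r) * r) * indicator {p..} r)"
    proof (cases "p \<le> r")
      case True
      then have r: "0 < r" using p by simp
      have sq: "(r\<^sup>2) powr (\<alpha> / 2) = r powr \<alpha>"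
        using r by (simp add: powr_powr flip: powr_numeral)
      have "1 / (1 + d powr (-\<alpha>) * (r\<^sup>2) powr (\<alpha> / 2) / \<gamma>) = 1 - L r"
      proof -
        have pos: "0 < r powr \<alpha>" "0 < d powr (-\<alpha>)" using r d by auto
        have "1 / (1 + b * c / \<gamma>) = 1 - 1 / (1 + \<gamma> * (1 / c) / b)" if "0 < b" "0 < c" for b c :: real
        proof -
          have "0 < \<gamma> + b * c" using that \<gamma> by (simp add: add_pos_pos)
          then show ?thesis using that \<gamma> by (simp add: divide_simps) (simp add: algebra_simps)
        qed
        from this[OF pos(2,1)] show ?thesis
          by (simp add: L sq powr_minus_divide)
      qed
      moreover have "0 \<le> 1 / (1 + d powr (-\<alpha>) * (r\<^sup>2) powr (\<alpha> / 2) / \<gamma>)"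
        using \<gamma> by (intro divide_nonneg_nonneg add_nonneg_nonneg mult_nonneg_nonneg) auto
      ultimately show ?thesis
        using r by (simp add: ennreal_mult' ac_simps)
    qed simp
  qed
  also have "\<dots> = 2 * (\<integral>\<^sup>+r\<in>{p..}. ennreal ((1 - L r) * r) \<partial>lborel)"
    unfolding L by (rule nn_integral_cmult) measurable
  finally have "(\<integral>\<^sup>+v\<in>{p\<^sup>2..}. ?f v \<partial>lborel) = 2 * (\<integral>\<^sup>+r\<in>{p..}. ennreal ((1 - L r) * r) \<partial>lborel)" .
  moreover have "ennreal (2 * pi * lam) = 2 * ennreal (pi * lam)"
    using ennreal_mult'[of 2 "pi * lam"] by (simp add: mult.assoc)
  ultimately show ?thesis
    by (simp only: mult_ac)
qed

text \<open>For D = top the quotient is 0 and both sides hold. At D = 0 the equivalence breaks for x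
  = 0: the quotient 0 / 0 is 0 in \<open>ennreal\<close>, so the left side holds and the right side
  does not.\<close>

lemma exceeds_threshold_iff:
  fixes a x \<gamma> :: real and D :: ennreal
  assumes a: "0 < a" and x: "0 \<le> x" and \<gamma>: "0 < \<gamma>" and D: "D \<noteq> 0"
  shows "ennreal (a * x) / D < ennreal \<gamma> \<longleftrightarrow> \<not> ennreal (\<gamma> / a) * D \<le> ennreal x"
proof (cases D)
  case (real d)
  with D have d: "0 < d" by auto
  have "a * x / d < \<gamma> \<longleftrightarrow> \<not> \<gamma> / a * d \<le> x"
    using a d by (simp add: field_simps not_le)
  moreover have "ennreal (a * x) / ennreal d = ennreal (a * x / d)"
    using a x d by (intro divide_ennreal) auto
  moreover have "ennreal (\<gamma> / a) * ennreal d = ennreal (\<gamma> / a * d)"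
    using a \<gamma> d by (intro ennreal_mult[symmetric]) auto
  ultimately show ?thesis
    using a x \<gamma> d unfolding real by (simp add: ennreal_less_iff)
next
  case top
  then show ?thesis
    using a \<gamma> by (simp add: ennreal_mult_top top_unique)
qed

section \<open>The cellular interference factor\<close>

text \<open>This is the Laplace transform 1 / (1 + s) of the cellular gain, with s the multiple of
  the gain that a user at distance r adds to the threshold of the desired link.\<close>

definition cellular_factor :: "real \<Rightarrow> real \<Rightarrow> real \<Rightarrow> real \<Rightarrow> real \<Rightarrow> real \<Rightarrow> real" where
  "cellular_factor \<alpha> P_d P_c r_d \<gamma> r = 1 / (1 + \<gamma> * P_c * r powr (-\<alpha>) / (P_d * r_d powr (-\<alpha>)))"

context
  fixes \<alpha> P_d P_c r_d R \<gamma> :: real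
  assumes pos: "0 < P_d" "0 < P_c" "0 < r_d" "0 < R" "0 < \<gamma>"
begin

lemma cellular_factor_bounds:
  "0 \<le> cellular_factor \<alpha> P_d P_c r_d \<gamma> r" "cellular_factor \<alpha> P_d P_c r_d \<gamma> r \<le> 1"
proof -
  have "0 \<le> \<gamma> * P_c * r powr (-\<alpha>) / (P_d * r_d powr (-\<alpha>))"
    using pos by (intro divide_nonneg_nonneg mult_nonneg_nonneg) auto
  then show "0 \<le> cellular_factor \<alpha> P_d P_c r_d \<gamma> r" "cellular_factor \<alpha> P_d P_c r_d \<gamma> r \<le> 1"
    unfolding cellular_factor_def by (simp_all add: divide_le_eq_1)
qed

text \<open>For positive \<alpha> the factor tends to 0 as r decreases to 0, but its value at 0 is 1
  because 0 to any power is 0 under \<open>powr\<close>. The density vanishes at 0 and absorbs the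
  jump.\<close>

lemma continuous_on_O1_integrand:
  "continuous_on {0..2 * R} (\<lambda>r. cellular_factor \<alpha> P_d P_c r_d \<gamma> r * disk_distance_density R r)"
proof (rule continuous_on_mult_vanishing_at_0)
  show "continuous_on {0..2 * R} (disk_distance_density R)"
    by (rule continuous_on_disk_distance_density) fact
  show "disk_distance_density R 0 = 0"
    by (simp add: disk_distance_density_def)
  show "isCont (cellular_factor \<alpha> P_d P_c r_d \<gamma>) x" if "0 < x" for x
  proof -
    have "1 + \<gamma> * P_c * x powr (-\<alpha>) / (P_d * r_d powr (-\<alpha>)) \<noteq> 0"
      using pos by (smt (verit) divide_nonneg_nonneg mult_nonneg_nonneg powr_ge_zero)
    then show ?thesis
      unfolding cellular_factor_def using that pos by (intro continuous_intros) auto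
  qed
  show "\<bar>cellular_factor \<alpha> P_d P_c r_d \<gamma> x\<bar> \<le> 1" for x
    using cellular_factor_bounds[of x] by simp
qed

lemma O1_ATP_eq_integral:
  "O1_ATP \<alpha> P_d P_c r_d R \<gamma> =
    integral {0..2 * R} (\<lambda>r. cellular_factor \<alpha> P_d P_c r_d \<gamma> r * disk_distance_density R r)"
  unfolding O1_ATP_def cellular_factor_def[symmetric]
  by (intro set_borel_integral_eq_integral borel_integrable_atLeastAtMost' continuous_on_O1_integrand)

lemma O1_ATP_quadrature_tendsto:
  "O1_ATP_quadrature \<alpha> P_d P_c r_d R \<gamma> \<longlonglongrightarrow> O1_ATP \<alpha> P_d P_c r_d R \<gamma>"
  using gauss_chebyshev_tendsto[OF continuous_on_O1_integrand] pos
  unfolding O1_ATP_eq_integral O1_ATP_quadrature_def[abs_def] Let_def cellular_factor_def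
  by (simp add: mult.assoc)

lemma nn_integral_cellular_factor:
  "(\<integral>\<^sup>+r. ennreal (disk_distance_density R r) * ennreal (cellular_factor \<alpha> P_d P_c r_d \<gamma> r) \<partial>lborel) =
    ennreal (O1_ATP \<alpha> P_d P_c r_d R \<gamma>)"
proof -
  let ?g = "\<lambda>r. cellular_factor \<alpha> P_d P_c r_d \<gamma> r * disk_distance_density R r"
  have int: "set_integrable lborel {0..2 * R} ?g"
    by (intro borel_integrable_atLeastAtMost' continuous_on_O1_integrand)
  have "(\<integral>\<^sup>+r. ennreal (disk_distance_density R r) * ennreal (cellular_factor \<alpha> P_d P_c r_d \<gamma> r) \<partial>lborel) =
      (\<integral>\<^sup>+r. ennreal (indicator {0..2 * R} r *\<^sub>R ?g r) \<partial>lborel)"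
    using cellular_factor_bounds disk_distance_density_nonneg[OF pos(4)]
    by (intro nn_integral_cong)
       (auto simp: ennreal_mult ac_simps disk_distance_density_def split: split_indicator)
  also have "\<dots> = ennreal (LBINT r:{0..2 * R}. ?g r)"
    unfolding set_lebesgue_integral_def
    using int cellular_factor_bounds disk_distance_density_nonneg[OF pos(4)]
    by (intro nn_integral_eq_integral) (auto simp: set_integrable_def)
  finally show ?thesis
    by (simp add: O1_ATP_def cellular_factor_def)
qed

lemma O1_ATP_nonneg: "0 \<le> O1_ATP \<alpha> P_d P_c r_d R \<gamma>"
  unfolding O1_ATP_eq_integral
  using cellular_factor_bounds disk_distance_density_nonneg[OF pos(4)]
  by (intro integral_nonneg integrable_continuous_real continuous_on_O1_integrand) auto

end

theorem mainTheorem6: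
  fixes M :: "'a measure"
    and R \<alpha> P_c P_b P_d P_s \<eta> T_s E_th \<beta>_th lam_d lam_t \<pi>_o p_t r_p r_d N0 \<gamma>_d :: real
    and i :: nat
    and U Y :: "'a \<Rightarrow> point"
    and X :: "nat \<Rightarrow> 'a \<Rightarrow> point"
    and h :: "nat \<Rightarrow> 'a \<Rightarrow> real" and h_c :: "'a \<Rightarrow> real"
    and battery :: "nat \<Rightarrow> 'a \<Rightarrow> real" and channel_clear :: "nat \<Rightarrow> 'a \<Rightarrow> bool"
    and \<Phi> :: "'a \<Rightarrow> nat set"
  assumes "prob_space M"
    (* parameters *)
    and "R > 0" "\<alpha> > 0" "P_c > 0" "P_b > 0" "P_d > 0" "P_s > 0" "0 < \<eta>" "\<eta> \<le> 1"
    and "0 < T_s" "T_s \<le> 1" "\<beta>_th > 0" "lam_d > 0" "r_d > 0" "N0 \<ge> 0" "\<gamma>_d > 0"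
    (* probabilities of being operable and of transmitting, density of the active set *)
    and "0 < \<pi>_o" "\<pi>_o \<le> 1"
    and "p_t = transmit_prob (W_ATP \<alpha> lam_d P_d \<beta>_th) \<pi>_o"
    and "\<pi>_o = (LBINT r:{0..R}.
           min 1 (\<eta> * P_b * r powr (-\<alpha>) / (P_s * (T_s / 2) + P_d * (1 - T_s / 2) * p_t))
             * (2 * r / R^2))"
    and "lam_t = lam_d * \<pi>_o * p_t"
    and "r_p = protection_radius \<alpha> P_d \<beta>_th"
    (* U: cellular user, Y: the i-th receiver, X j: transmitter j *)
    and "U \<in> borel_measurable M" "distr M lborel U = uniform_measure lborel (cball 0 R)"
    and "Y \<in> borel_measurable M" "distr M lborel Y = uniform_measure lborel (cball 0 R)"
    and "prob_space.indep_var M borel U borel Y"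
    and "X i \<in> borel_measurable M" "AE \<omega> in M. dist (X i \<omega>) (Y \<omega>) = r_d"
    and "homogeneous_ppp M lam_d X (- {i})"
    (* operable and transmitting transmitters *)
    and "\<And>j. battery j \<in> borel_measurable M"
    and "\<And>j. Measurable.pred M (channel_clear j)"
    and "\<Phi> = active_set E_th battery channel_clear"
    (* Rayleigh fading: h j is the power gain (squared modulus) from transmitter j to receiver i *)
    and "\<And>j \<omega>. h j \<omega> \<ge> 0" "\<And>\<omega>. h_c \<omega> \<ge> 0"
    and "\<And>j. distributed M lborel (h j) (exponential_density 1)"
    and "distributed M lborel h_c (exponential_density 1)"
    and "prob_space.indep_vars M (\<lambda>_. borel) (case_option h_c h) UNIV"
    (* the gains, the pair (U, Y), and the interferers as seen from Y are independent *)
    and "indep_rvs M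
           (\<Pi>\<^sub>M _\<in>UNIV. borel) (\<lambda>\<omega> k. case_option h_c h k \<omega>)
           ((borel \<Otimes>\<^sub>M borel) \<Otimes>\<^sub>M (\<Pi>\<^sub>M _\<in>- {i}. borel \<Otimes>\<^sub>M count_space UNIV))
           (\<lambda>\<omega>. ((U \<omega>, Y \<omega>), \<lambda>j\<in>- {i}. (dist (X j \<omega>) (Y \<omega>), j \<in> \<Phi> \<omega>)))"
    and "indep_rvs M
           (borel \<Otimes>\<^sub>M borel) (\<lambda>\<omega>. (U \<omega>, Y \<omega>))
           (\<Pi>\<^sub>M _\<in>- {i}. borel \<Otimes>\<^sub>M count_space UNIV)
           (\<lambda>\<omega>. \<lambda>j\<in>- {i}. (dist (X j \<omega>) (Y \<omega>), j \<in> \<Phi> \<omega>))"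
    (* the D2D interference factor *)
    and "\<And>l. l \<noteq> i \<Longrightarrow>
           (\<integral>\<omega>. infprod (\<lambda>j. exp (- (\<gamma>_d * h j \<omega> * dist (X j \<omega>) (Y \<omega>) powr (-\<alpha>)
                                          / r_d powr (-\<alpha>)))) (\<Phi> \<omega> - {i}) \<partial>M)
             = exp_neg (ennreal (2 * pi * lam_t) *
                 (\<integral>\<^sup>+r\<in>{r_p..}. ennreal
                    ((1 - (\<integral>\<omega>. exp (- (\<gamma>_d * h l \<omega> * r powr (-\<alpha>) / r_d powr (-\<alpha>))) \<partial>M)) * r)
                  \<partial>lborel))"
  shows "distributed M lborel (\<lambda>\<omega>. dist (U \<omega>) (Y \<omega>)) (disk_distance_density R)
    \<and> outage_prob M
        (\<lambda>\<omega>. sinr \<alpha> P_d P_c N0 r_d i (\<Phi> \<omega>) (\<lambda>j. h j \<omega>) (\<lambda>j. dist (X j \<omega>) (Y \<omega>))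
                (h_c \<omega>) (dist (U \<omega>) (Y \<omega>))) \<gamma>_d
      = 1 - exp (- (\<gamma>_d * N0 / (P_d * r_d powr (-\<alpha>))))
          * exp_neg (ennreal (pi * lam_t) *
              (\<integral>\<^sup>+v\<in>{r_p\<^sup>2..}. ennreal (1 / (1 + r_d powr (-\<alpha>) * v powr (\<alpha> / 2) / \<gamma>_d)) \<partial>lborel))
          * O1_ATP \<alpha> P_d P_c r_d R \<gamma>_d
    \<and> O1_ATP_quadrature \<alpha> P_d P_c r_d R \<gamma>_d \<longlonglongrightarrow> O1_ATP \<alpha> P_d P_c r_d R \<gamma>_d"
proof (intro conjI)
  \<comment> \<open>C converts the SINR condition into a threshold: the SINR is at least
    \<open>\<gamma>_d\<close> when \<open>h i\<close> is at least C times the denominator.\<close>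
  define C where "C = \<gamma>_d / (P_d * r_d powr (-\<alpha>))"
  define A where "A = P_d * r_d powr (-\<alpha>)"
  have A: "0 < A" using assms(6,14) by (simp add: A_def)
  have C: "0 < C" "C = \<gamma>_d / A" using assms(6,14,16) by (simp_all add: C_def A_def)
  interpret prob_space M by (fact assms(1))
  note U[measurable] = assms(23) and Y[measurable] = assms(25)
  note h_nonneg = assms(34) and hc_nonneg = assms(35) and h_exp = assms(36) and hc_exp = assms(37)
  note vars = assms(38) and HV = assms(39) and WZ = assms(40)
  show dist: "distributed M lborel (\<lambda>\<omega>. dist (U \<omega>) (Y \<omega>)) (disk_distance_density R)"
    by (rule distributed_dist_uniform_disk) (fact assms(1,2,23-27))+
  show "O1_ATP_quadrature \<alpha> P_d P_c r_d R \<gamma>_d \<longlonglongrightarrow> O1_ATP \<alpha> P_d P_c r_d R \<gamma>_d"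
    by (rule O1_ATP_quadrature_tendsto) (fact assms(2,4,6,14,16))+

  \<comment> \<open>\<open>None\<close> indexes the cellular gain and \<open>Some j\<close> that of
    transmitter j, so that one family carries the joint independence of all gains.\<close>
  define H where "H = case_option h_c h"
  define s where "s w = C * P_c * dist (fst w) (snd w) powr (-\<alpha>)" for w :: "point \<times> point"
  define x where "x j \<omega> = C * (P_d * h j \<omega> * dist (X j \<omega>) (Y \<omega>) powr (-\<alpha>))" for j \<omega>
  define Z where "Z \<omega> = (\<lambda>j\<in>- {i}. (dist (X j \<omega>) (Y \<omega>), j \<in> \<Phi> \<omega>))" for \<omega>
  \<comment> \<open>J rebuilds the interference from two separate arguments, the gains and the marks
    (distance, active or not), so that one can be frozen while the other stays random.\<close>
  define J where "J p = (\<Sum>j. if j \<noteq> i \<and> snd (snd p j)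
      then ennreal (C * (P_d * fst p (Some j) * fst (snd p j) powr (-\<alpha>))) else 0)"
    for p :: "(nat option \<Rightarrow> real) \<times> (nat \<Rightarrow> real \<times> bool)"
  define I where "I \<omega> = (\<Sum>\<^sub>\<infinity>j\<in>\<Phi> \<omega> - {i}. ennreal (x j \<omega>))" for \<omega>
  define G where "G \<omega> = I \<omega> + ennreal (s (U \<omega>, Y \<omega>) * h_c \<omega>) + ennreal (C * N0)" for \<omega>
  let ?sinr = "\<lambda>\<omega>. sinr \<alpha> P_d P_c N0 r_d i (\<Phi> \<omega>) (\<lambda>j. h j \<omega>) (\<lambda>j. dist (X j \<omega>) (Y \<omega>)) (h_c \<omega>) (dist (U \<omega>) (Y \<omega>))"

  have x_nonneg: "0 \<le> x j \<omega>" for j \<omega>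
    using C(1) h_nonneg assms(6) by (simp add: x_def)
  have s_nonneg: "0 \<le> s w" for w
    using C(1) assms(4) by (simp add: s_def)
  have [measurable]: "h j \<in> borel_measurable M" "h_c \<in> borel_measurable M" for j
    using distributed_measurable[OF h_exp] distributed_measurable[OF hc_exp] by auto
  have [measurable]: "X j \<in> borel_measurable M" for j
    using assms(28,30) by (cases "j = i") (auto simp: homogeneous_ppp_def)
  have [measurable]: "Measurable.pred M (\<lambda>\<omega>. j \<in> \<Phi> \<omega>)" for j
    using assms(31,32) unfolding assms(33) active_set_def by simp
  have I_suminf: "I \<omega> = (\<Sum>j. if j \<in> \<Phi> \<omega> - {i} then ennreal (x j \<omega>) else 0)" for \<omega>
    unfolding I_def by (rule infsum_ennreal_eq_suminf)
  have [measurable]: "x j \<in> borel_measurable M" for j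
    unfolding x_def[abs_def] by measurable
  have [measurable]: "I \<in> borel_measurable M"
    unfolding I_suminf[abs_def] by measurable
  have [measurable]: "s \<in> borel_measurable (borel \<Otimes>\<^sub>M borel)"
    unfolding s_def[abs_def] by measurable
  have [measurable]: "G \<in> borel_measurable M"
    unfolding G_def[abs_def] by measurable
  have J_eq: "J (\<lambda>k\<in>- {Some i, None}. H k \<omega>, Z \<omega>) = I \<omega>" for \<omega>
    unfolding J_def I_suminf by (intro suminf_cong) (auto simp: Z_def H_def x_def)
  have J[measurable]: "J \<in> borel_measurable ((\<Pi>\<^sub>M _\<in>- {Some i, None}. borel) \<Otimes>\<^sub>M (\<Pi>\<^sub>M _\<in>- {i}. borel \<Otimes>\<^sub>M count_space UNIV))"
    unfolding J_def[abs_def]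
  proof (rule borel_measurable_suminf_order)
    fix j
    show "(\<lambda>p. if j \<noteq> i \<and> snd (snd p j) then ennreal (C * (P_d * fst p (Some j) * fst (snd p j) powr (-\<alpha>))) else 0)
      \<in> borel_measurable ((\<Pi>\<^sub>M _\<in>- {Some i, None}. borel) \<Otimes>\<^sub>M (\<Pi>\<^sub>M _\<in>- {i}. borel \<Otimes>\<^sub>M count_space UNIV))"
    \<comment> \<open>The gain at \<open>Some i\<close> and the mark at i lie outside the index sets
      of the product spaces; the guard \<open>j \<noteq> i\<close> makes this term constant.\<close>
    proof (cases "j = i")
      case False
      have [measurable]: "(\<lambda>p. fst p (Some j)) \<in> borel_measurable ((\<Pi>\<^sub>M _\<in>- {Some i, None}. borel :: real measure) \<Otimes>\<^sub>M (\<Pi>\<^sub>M _\<in>- {i}. borel \<Otimes>\<^sub>M count_space UNIV :: (real \<times> bool) measure))"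
        using False by (intro measurable_compose[OF measurable_fst measurable_component_singleton]) auto
      have [measurable]: "(\<lambda>p. snd p j) \<in> measurable ((\<Pi>\<^sub>M _\<in>- {Some i, None}. borel :: real measure) \<Otimes>\<^sub>M (\<Pi>\<^sub>M _\<in>- {i}. borel \<Otimes>\<^sub>M count_space UNIV :: (real \<times> bool) measure)) (borel \<Otimes>\<^sub>M count_space UNIV)"
        using False by (intro measurable_compose[OF measurable_snd measurable_component_singleton]) auto
      show ?thesis by measurable
    qed simp
  qed

  have covered: "(\<integral>\<^sup>+\<omega>. indicator {y. G \<omega> \<le> ennreal y} (h i \<omega>) \<partial>M) =
    ennreal (exp (- (C * N0))) * (\<integral>\<^sup>+\<omega>. ennreal (exp_neg (I \<omega>)) \<partial>M) *
      (\<integral>\<^sup>+\<omega>. ennreal (1 / (1 + s (U \<omega>, Y \<omega>))) \<partial>M)"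
  proof -
    have "Some i \<noteq> None" by simp
    from nn_integral_exponential_threshold[OF this, of H "borel \<Otimes>\<^sub>M borel"
        "\<Pi>\<^sub>M _\<in>- {i}. borel \<Otimes>\<^sub>M count_space UNIV" "\<lambda>\<omega>. (U \<omega>, Y \<omega>)" Z J s "C * N0"]
    show ?thesis
      using vars HV WZ h_exp hc_exp hc_nonneg s_nonneg J C(1) assms(15)
      unfolding J_eq by (simp add: H_def Z_def[abs_def] G_def)
  qed

  have interference: "(\<integral>\<^sup>+\<omega>. ennreal (exp_neg (I \<omega>)) \<partial>M) =
    ennreal (exp_neg (ennreal (pi * lam_t) *
      (\<integral>\<^sup>+v\<in>{r_p\<^sup>2..}. ennreal (1 / (1 + r_d powr (-\<alpha>) * v powr (\<alpha> / 2) / \<gamma>_d)) \<partial>lborel)))"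
  proof -
    \<comment> \<open>\<open>Suc i\<close> is merely an index different from i, as the interference
      identity requires; all gains have the same law.\<close>
    let ?L = "\<lambda>r. \<integral>\<omega>. exp (- (\<gamma>_d * h (Suc i) \<omega> * r powr (-\<alpha>) / r_d powr (-\<alpha>))) \<partial>M"
    have L: "?L r = 1 / (1 + \<gamma>_d * r powr (-\<alpha>) / r_d powr (-\<alpha>))" for r
    proof -
      have nonneg: "0 \<le> \<gamma>_d * r powr (-\<alpha>) / r_d powr (-\<alpha>)" using assms(16) by simp
      have "ennreal (?L r) = (\<integral>\<^sup>+\<omega>. ennreal (exp (- (\<gamma>_d * r powr (-\<alpha>) / r_d powr (-\<alpha>) * h (Suc i) \<omega>))) \<partial>M)"
        using assms(16) h_nonneg
        by (subst nn_integral_eq_integral)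
           (auto intro!: integrable_const_bound[where B = 1] simp: ac_simps)
      also have "\<dots> = ennreal (1 / (1 + \<gamma>_d * r powr (-\<alpha>) / r_d powr (-\<alpha>)))"
        by (rule exponential_Laplace[OF h_exp nonneg])
      finally show ?thesis
        using nonneg by (subst (asm) ennreal_inj) (auto intro!: integral_nonneg)
    qed
    have p: "0 < r_p"
      unfolding assms(22) protection_radius_def
      using assms(3,6,12) by (intro mult_pos_pos Gamma_real_pos) (auto intro: add_pos_pos)
    \<comment> \<open>The power \<open>P_d\<close> of each interferer cancels against the one in C,
      which leaves exactly the exponents of the interference identity.\<close>
    have "exp_neg (I \<omega>) = infprod (\<lambda>j. exp (- (\<gamma>_d * h j \<omega> * dist (X j \<omega>) (Y \<omega>) powr (-\<alpha>) / r_d powr (-\<alpha>)))) (\<Phi> \<omega> - {i})" for \<omega>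
      using infprod_exp_neg[of "\<Phi> \<omega> - {i}" "\<lambda>j. x j \<omega>"] x_nonneg assms(6)
      by (simp add: I_def x_def C_def mult.assoc)
    then have "(\<integral>\<omega>. exp_neg (I \<omega>) \<partial>M) = exp_neg (ennreal (2 * pi * lam_t) *
        (\<integral>\<^sup>+r\<in>{r_p..}. ennreal ((1 - ?L r) * r) \<partial>lborel))"
      using assms(41)[of "Suc i"] by simp
    also have "ennreal (2 * pi * lam_t) * (\<integral>\<^sup>+r\<in>{r_p..}. ennreal ((1 - ?L r) * r) \<partial>lborel) =
        ennreal (pi * lam_t) * (\<integral>\<^sup>+v\<in>{r_p\<^sup>2..}. ennreal (1 / (1 + r_d powr (-\<alpha>) * v powr (\<alpha> / 2) / \<gamma>_d)) \<partial>lborel)"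
      using assms(3,14,16) p by (intro interference_exponent_square_substitution L) auto
    finally show ?thesis
      by (subst nn_integral_eq_integral)
         (auto intro!: integrable_const_bound[where B = 1] simp: exp_neg_nonneg exp_neg_le_1)
  qed

  have cellular: "(\<integral>\<^sup>+\<omega>. ennreal (1 / (1 + s (U \<omega>, Y \<omega>))) \<partial>M) = ennreal (O1_ATP \<alpha> P_d P_c r_d R \<gamma>_d)"
  proof -
    have "1 / (1 + s (U \<omega>, Y \<omega>)) = cellular_factor \<alpha> P_d P_c r_d \<gamma>_d (dist (U \<omega>) (Y \<omega>))" for \<omega>
      by (simp add: s_def C_def cellular_factor_def)
    then have "(\<integral>\<^sup>+\<omega>. ennreal (1 / (1 + s (U \<omega>, Y \<omega>))) \<partial>M) =
        (\<integral>\<^sup>+r. ennreal (disk_distance_density R r) * ennreal (cellular_factor \<alpha> P_d P_c r_d \<gamma>_d r) \<partial>lborel)"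
      by (subst distributed_nn_integral[OF dist]) (auto simp: cellular_factor_def[abs_def])
    also have "\<dots> = ennreal (O1_ATP \<alpha> P_d P_c r_d R \<gamma>_d)"
      by (rule nn_integral_cellular_factor) (fact assms(2,4,6,14,16))+
    finally show ?thesis .
  qed

  \<comment> \<open>Together the two conditions make the cellular term of the denominator positive,
    even for N0 = 0 and no active interferer; the distance matters because 0 to any power is 0 under
    \<open>powr\<close>. They fail with probability 0, since gain and distance have
    densities.\<close>
  have outage_iff: "?sinr \<omega> < ennreal \<gamma>_d \<longleftrightarrow> \<not> G \<omega> \<le> ennreal (h i \<omega>)"
    if nz: "h_c \<omega> \<noteq> 0" "dist (U \<omega>) (Y \<omega>) \<noteq> 0" for \<omega>
  proof -
    define D where "D = (\<Sum>\<^sub>\<infinity>j\<in>\<Phi> \<omega> - {i}. ennreal (P_d * h j \<omega> * dist (X j \<omega>) (Y \<omega>) powr (-\<alpha>)))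
      + ennreal (P_c * h_c \<omega> * dist (U \<omega>) (Y \<omega>) powr (-\<alpha>)) + ennreal N0"
    have "0 < P_c * h_c \<omega> * dist (U \<omega>) (Y \<omega>) powr (-\<alpha>)"
      using nz hc_nonneg[of \<omega>] assms(4) by (intro mult_pos_pos) auto
    then have "D \<noteq> 0" using nz assms(4) by (simp add: D_def)
    from exceeds_threshold_iff[OF A h_nonneg[of i \<omega>] assms(16) this]
    have "ennreal (A * h i \<omega>) / D < ennreal \<gamma>_d \<longleftrightarrow> \<not> ennreal C * D \<le> ennreal (h i \<omega>)"
      by (simp only: C(2))
    moreover have "?sinr \<omega> = ennreal (A * h i \<omega>) / D"
      by (simp add: sinr_def D_def A_def ac_simps)
    moreover have "ennreal C * D = G \<omega>"
    proof -
      have "ennreal C * (\<Sum>\<^sub>\<infinity>j\<in>\<Phi> \<omega> - {i}. ennreal (P_d * h j \<omega> * dist (X j \<omega>) (Y \<omega>) powr (-\<alpha>))) = I \<omega>"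
        unfolding I_suminf infsum_ennreal_eq_suminf ennreal_suminf_cmult[symmetric]
        using C(1) by (intro suminf_cong) (auto simp: x_def ennreal_mult')
      moreover have "ennreal C * ennreal (P_c * h_c \<omega> * dist (U \<omega>) (Y \<omega>) powr (-\<alpha>)) = ennreal (s (U \<omega>, Y \<omega>) * h_c \<omega>)"
        using C(1) by (simp add: s_def ac_simps flip: ennreal_mult')
      moreover have "ennreal C * ennreal N0 = ennreal (C * N0)"
        using C(1) by (simp add: ennreal_mult')
      ultimately show ?thesis
        by (simp only: D_def G_def distrib_left)
    qed
    ultimately show ?thesis by simp
  qed

  have [measurable]: "?sinr \<in> borel_measurable M"
    unfolding sinr_def infsum_ennreal_eq_suminf by measurable
  have "prob {\<omega> \<in> space M. ?sinr \<omega> < ennreal \<gamma>_d} = prob {\<omega> \<in> space M. \<not> G \<omega> \<le> ennreal (h i \<omega>)}"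
  proof (rule finite_measure_eq_AE)
    show "AE \<omega> in M. (\<omega> \<in> {\<omega> \<in> space M. ?sinr \<omega> < ennreal \<gamma>_d}) = (\<omega> \<in> {\<omega> \<in> space M. \<not> G \<omega> \<le> ennreal (h i \<omega>)})"
      using AE_distributed_lborel_neq[OF hc_exp, of 0] AE_distributed_lborel_neq[OF dist, of 0]
      by eventually_elim (use outage_iff in auto)
  qed measurable
  also have "\<dots> = 1 - prob {\<omega> \<in> space M. G \<omega> \<le> ennreal (h i \<omega>)}"
    by (rule prob_neg) measurable
  also have "prob {\<omega> \<in> space M. G \<omega> \<le> ennreal (h i \<omega>)} = exp (- (C * N0)) *
      exp_neg (ennreal (pi * lam_t) *
        (\<integral>\<^sup>+v\<in>{r_p\<^sup>2..}. ennreal (1 / (1 + r_d powr (-\<alpha>) * v powr (\<alpha> / 2) / \<gamma>_d)) \<partial>lborel)) *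
      O1_ATP \<alpha> P_d P_c r_d R \<gamma>_d" (is "_ = ?rhs")
  proof -
    have O1: "0 \<le> O1_ATP \<alpha> P_d P_c r_d R \<gamma>_d"
      by (rule O1_ATP_nonneg) (fact assms(2,4,6,14,16))+
    have "ennreal (prob {\<omega> \<in> space M. G \<omega> \<le> ennreal (h i \<omega>)}) = (\<integral>\<^sup>+\<omega>. indicator {\<omega> \<in> space M. G \<omega> \<le> ennreal (h i \<omega>)} \<omega> \<partial>M)"
      by (simp add: emeasure_eq_measure)
    also have "\<dots> = (\<integral>\<^sup>+\<omega>. indicator {y. G \<omega> \<le> ennreal y} (h i \<omega>) \<partial>M)"
      by (intro nn_integral_cong) (auto simp: indicator_def)
    also have "\<dots> = ennreal ?rhs"
      unfolding covered interference cellular using O1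
      by (simp add: ennreal_mult exp_neg_nonneg)
    finally show ?thesis
      using O1 by (subst (asm) ennreal_inj) (auto simp: exp_neg_nonneg)
  qed
  finally show "outage_prob M ?sinr \<gamma>_d = 1 - exp (- (\<gamma>_d * N0 / (P_d * r_d powr (-\<alpha>)))) *
      exp_neg (ennreal (pi * lam_t) *
        (\<integral>\<^sup>+v\<in>{r_p\<^sup>2..}. ennreal (1 / (1 + r_d powr (-\<alpha>) * v powr (\<alpha> / 2) / \<gamma>_d)) \<partial>lborel)) *
      O1_ATP \<alpha> P_d P_c r_d R \<gamma>_d"
    by (simp add: outage_prob_def C_def)
qed

end
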